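(* Let $\alpha\ge\beta\ge-1/2$ with $\alpha>-1/2$, and let $\rho:=\alpha+\beta+1$. Then there exists a constant $C=C(\alpha,\beta)$ such that for all $t\ge0$ and $\lambda\in\mathbb R$, $$\bigl|\varphi_{i\rho-\lambda}^{(\alpha,\beta)}(t)-e^{i\lambda m_1(t)}\bigr|\le C(\lambda^2+|\lambda|^3).$$
   Context: The Jacobi functions are $$\varphi_\mu^{(\alpha,\beta)}(t):={}_2F_1\bigl((\alpha+\beta+1-i\mu)/2,(\alpha+\beta+1+i\mu)/2;\alpha+1;-\sinh^2t\bigr)\qquad(\mu\in\mathbb C,\ t\ge0),$$ where ${}_2F_1$ is the Gauss hypergeometric function (analytically continued to $\mathbb C\setminus[1,\infty[$). The first moment function is $$m_1(t):=m_1^{(\alpha,\beta)}(t):=\frac{\partial}{\partial\lambda}\varphi_{i\rho+i\lambda}^{(\alpha,\beta)}(t)\Big|_{\lambda=0}\qquad(t\ge0).$$ *)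

theory Defs
  imports "HOL-Complex_Analysis.Complex_Analysis"
begin

definition slit_plane :: "complex set" where
  "slit_plane = - (complex_of_real ` {1..})"

text \<open>
  The Gauss hypergeometric function \<open>\<^sub>2F\<^sub>1(a, b; c; z)\<close>: the analytic continuation to the plane
  slit along \<open>[1, \<infinity>)\<close> of the hypergeometric series, which converges in the unit disc.
  The values at points outside \<open>slit_plane\<close>, and the values for \<open>c\<close> a non-positive integer,
  carry no meaning.
\<close>
definition is_hyp2F1 :: "complex \<Rightarrow> complex \<Rightarrow> complex \<Rightarrow> (complex \<Rightarrow> complex) \<Rightarrow> bool" where
  "is_hyp2F1 a b c F \<longleftrightarrow>
     F holomorphic_on slit_plane \<and>
     (\<forall>z\<in>ball 0 1. F z = eval_fps (fps_hypergeo [a, b] [c] 1) z)"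

definition hyp2F1 :: "complex \<Rightarrow> complex \<Rightarrow> complex \<Rightarrow> complex \<Rightarrow> complex" where
  "hyp2F1 a b c = (SOME F. is_hyp2F1 a b c F)"

lemma is_hyp2F1_unique:
  assumes F: "is_hyp2F1 a b c F" and G: "is_hyp2F1 a b c G" and z: "z \<in> slit_plane"
  shows "F z = G z"
proof (rule analytic_continuation_open[of "ball 0 1" slit_plane F G])
  show "open slit_plane"
    unfolding slit_plane_def
    by (intro open_Compl closed_injective_image_subspace closed_slot_right)
  show "connected slit_plane"
    unfolding slit_plane_def by (intro starlike_imp_connected starlike_slotted_complex_plane_right)
  show "ball 0 1 \<subseteq> slit_plane"
    by (auto simp: slit_plane_def)
qed (use F G z in \<open>auto simp: is_hyp2F1_def\<close>)

lemma hyp2F1_eq: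
  assumes "is_hyp2F1 a b c F" "z \<in> slit_plane"
  shows "hyp2F1 a b c z = F z"
  using assms is_hyp2F1_unique someI[of "is_hyp2F1 a b c" F] unfolding hyp2F1_def by blast

definition jacobi_rho :: "real \<Rightarrow> real \<Rightarrow> real" where
  "jacobi_rho \<alpha> \<beta> = \<alpha> + \<beta> + 1"

definition jacobi_fun :: "real \<Rightarrow> real \<Rightarrow> complex \<Rightarrow> real \<Rightarrow> complex" where
  "jacobi_fun \<alpha> \<beta> \<mu> t =
     hyp2F1 ((of_real (\<alpha> + \<beta> + 1) - \<i> * \<mu>) / 2) ((of_real (\<alpha> + \<beta> + 1) + \<i> * \<mu>) / 2)
       (of_real (\<alpha> + 1)) (of_real (- (sinh t)\<^sup>2))"

text \<open>
  Differentiation is with respect to the complex variable \<open>\<lambda>\<close>. The moment function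
  is real-valued as a mathematical fact, but it is kept complex-valued here, so that nothing is
  discarded by taking a real part.
\<close>
definition jacobi_m1 :: "real \<Rightarrow> real \<Rightarrow> real \<Rightarrow> complex" where
  "jacobi_m1 \<alpha> \<beta> t =
     deriv (\<lambda>l. jacobi_fun \<alpha> \<beta> (\<i> * of_real (jacobi_rho \<alpha> \<beta>) + \<i> * l) t) 0"

end

theory Submission
  imports Defs
begin

text \<open>
  Put \<open>l = \<i>\<lambda>\<close>. The function \<open>u(t) = \<phi>\<^bsub>\<i>\<rho>-\<lambda>\<^esub>(t)\<close> solves the radial eigenvalue equation
  \<open>u'' + a u' = l(2\<rho> + l) u\<close> with \<open>u(0) = 1\<close>, \<open>u'(0) = 0\<close>, where \<open>a = A'/A\<close> is the logarithmic
  derivative of the weight \<open>A = sinh\<^bsup>2\<alpha>+1\<^esup> cosh\<^bsup>2\<beta>+1\<^esup>\<close>. The first moment \<open>m = m\<^sub>1\<close> solves the equation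
  \<open>m'' + a m' = 2\<rho>\<close> obtained by differentiating at \<open>l = 0\<close>, so \<open>k = m'\<close> is \<open>2\<rho>/A\<close> times the primitive of \<open>A\<close>.
  Everything follows from these equations and three properties of the weight: \<open>A(0) = 0\<close>, \<open>a \<ge> 2\<rho>\<close>
  (here \<open>\<alpha> \<ge> \<beta>\<close> enters), and \<open>A(t) \<le> exp(2\<rho>t)\<close>.

  The product rule gives \<open>(A e\<^bsup>lm\<^esup> (u' - l k u))' = l\<^sup>2 A e\<^bsup>lm\<^esup> (1 - k\<^sup>2) u\<close>. As \<open>l\<close> is purely imaginary,
  \<open>\<bar>e\<^bsup>lm\<^esup>\<bar> = 1\<close>, and since \<open>\<bar>u\<bar> \<le> 1\<close> and \<open>0 \<le> k \<le> 1\<close> we get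
  \<open>\<bar>(u e\<^bsup>-lm\<^esup>)'\<bar> = \<bar>u' - l k u\<bar> \<le> \<lambda>\<^sup>2 \<psi>\<close>, where \<open>\<psi>\<close> is \<open>2/A\<close> times the primitive of \<open>A(1 - k)\<close>.
  The bound \<open>\<bar>u - e\<^bsup>lm\<^esup>\<bar> \<le> C \<lambda>\<^sup>2\<close> then amounts to the integrability of \<open>\<psi>\<close> on the half-line
  (lemma \<open>moment_approximation\<close>). Near \<open>0\<close> we have \<open>\<psi>(t) \<le> 2t\<close>; on \<open>[1, \<infinity>)\<close> the function \<open>\<psi>\<close> is dominated
  by the derivative of an explicit function \<open>\<Phi> \<le> 0\<close>.

  The bound \<open>\<bar>u\<bar> \<le> 1\<close> (lemma \<open>eigenfunction_bounded\<close>) comes from splitting \<open>u = p + n\<close> with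
  \<open>p = (u + u'/l)/2\<close> and \<open>n = (u - u'/l)/2\<close>: the first-order system for \<open>(p, n)\<close> is a phase rotation plus
  an exchange of mass at the nonnegative rates \<open>(a - 2\<rho>)/2\<close> and \<open>(a + 2\<rho>)/2\<close>, so \<open>\<bar>p\<bar> + \<bar>n\<bar>\<close>, which equals \<open>1\<close> at
  \<open>t = 0\<close>, never increases.

  It remains to derive the differential equation from the definition by analytic continuation. The
  Koebe map \<open>w \<mapsto> 4w/(1 + w)\<^sup>2\<close> carries the unit disc onto the slit plane. In the
  variable \<open>w\<close> the singular points of the hypergeometric equation are \<open>0\<close>, \<open>1\<close> and \<open>-1\<close>, hence its power series
  solution at \<open>0\<close> converges in the whole disc and supplies both the continuation and its equation
  (lemma \<open>hyp2F1_ode\<close>).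
\<close>

section \<open>Power series solutions at a regular singular point\<close>

text \<open>
  Frobenius's method for \<open>\<theta>\<^sup>2 g + (c - 1) \<theta> g = P \<theta> g + Q g\<close>, where \<open>\<theta> = w d/dw\<close> and \<open>P\<close>, \<open>Q\<close> are power
  series without constant term: the coefficients of the solution with value \<open>1\<close> at the origin.
\<close>

function frobenius :: "(nat \<Rightarrow> complex) \<Rightarrow> (nat \<Rightarrow> complex) \<Rightarrow> complex \<Rightarrow> nat \<Rightarrow> complex" where
  "frobenius p q c n = (if n = 0 then 1 else
     (\<Sum>i=1..n. (p i * of_nat (n - i) + q i) * frobenius p q c (n - i)) /
     (of_nat n * (of_nat n - 1 + c)))"
  by auto
termination by (relation "Wellfounded.measure (\<lambda>(p,q,c,n). n)") auto

declare frobenius.simps [simp del]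

lemma frobenius_0 [simp]: "frobenius p q c 0 = 1"
  by (subst frobenius.simps) simp

lemma frobenius_rec:
  assumes c: "\<And>n. c \<noteq> - of_nat n" and "p 0 = 0" "q 0 = 0"
  shows "of_nat n * (of_nat n - 1 + c) * frobenius p q c n =
    (\<Sum>i=0..n. (p i * of_nat (n - i) + q i) * frobenius p q c (n - i))"
proof (cases n)
  case 0
  then show ?thesis using assms by simp
next
  case (Suc m)
  have "of_nat n - 1 + c \<noteq> 0"
    using c[of m] Suc by (auto simp: add_eq_0_iff)
  moreover have "(of_nat n :: complex) \<noteq> 0" using Suc by (simp del: of_nat_Suc)
  ultimately have "of_nat n * (of_nat n - 1 + c) * frobenius p q c n =
    (\<Sum>i=1..n. (p i * of_nat (n - i) + q i) * frobenius p q c (n - i))"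
    using Suc by (subst frobenius.simps) auto
  also have "\<dots> = (\<Sum>i=0..n. (p i * of_nat (n - i) + q i) * frobenius p q c (n - i))"
    using assms by (simp add: sum.atLeast_Suc_atMost[of 0 n])
  finally show ?thesis .
qed

text \<open>
  The bounds on \<open>p\<close> and \<open>q\<close> are those of rational functions with at most simple, respectively double,
  poles on the unit circle. The recursion gives \<open>\<bar>g\<^sub>n\<bar> \<le> (B D / n) S\<^sub>n\<^sub>-\<^sub>1\<close> with the partial sums \<open>S\<^sub>n = \<bar>g\<^sub>0\<bar> + \<dots> + \<bar>g\<^sub>n\<bar>\<close>, so
  \<open>S\<^sub>n / S\<^sub>n\<^sub>-\<^sub>1 \<le> 1 + O(1/n)\<close> and the ratio test applies to \<open>S\<^sub>n r\<^sup>n\<close>.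
\<close>

lemma frobenius_summable:
  assumes c: "\<And>n. c \<noteq> - of_nat n"
    and p: "\<And>k. cmod (p k) \<le> B" and q: "\<And>k. cmod (q k) \<le> B * real k"
    and r: "0 \<le> r" "r < 1"
  shows "summable (\<lambda>n. cmod (frobenius p q c n) * r ^ n)"
proof -
  define g where "g = frobenius p q c"
  define S where "S n = (\<Sum>k\<le>n. cmod (g k))" for n
  have B0: "B \<ge> 0" using p[of 0] norm_ge_zero order_trans by blast
  have S0: "S n \<ge> 0" for n unfolding S_def by (simp add: sum_nonneg)
  \<comment> \<open>The terms are \<open>n / (n - 1 + c)\<close>; a bound \<open>D\<close> for them makes \<open>n (n - 1 + c)\<close> comparable to \<open>n\<^sup>2\<close>.\<close>
  have "(\<lambda>n. inverse (1 + (c - 1) / of_nat n)) \<longlonglongrightarrow> inverse (1 + 0)"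
    by (intro tendsto_intros lim_const_over_n) auto
  then have "Bseq (\<lambda>n. inverse (1 + (c - 1) / of_nat n))"
    by (intro convergent_imp_Bseq) (auto simp: convergent_def)
  then obtain D where D: "D > 0" "\<And>n. cmod (inverse (1 + (c - 1) / of_nat n)) \<le> D"
    by (auto elim: BseqE)
  have g_le: "cmod (g (Suc n)) \<le> D * B / real (Suc n) * S n" for n
  proof -
    define m where "m = Suc n"
    have m: "real m > 0" "(of_nat m :: complex) \<noteq> 0" "of_nat m - 1 = (of_nat n :: complex)"
      by (simp_all add: m_def del: of_nat_Suc) simp
    have nz: "of_nat n + c \<noteq> 0" using c[of n] by (auto simp: add_eq_0_iff)
    have "cmod (\<Sum>i=1..m. (p i * of_nat (m - i) + q i) * g (m - i))
        \<le> (\<Sum>i=1..m. (B * real m) * cmod (g (m - i)))"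
    proof (rule sum_norm_le)
      fix i assume i: "i \<in> {1..m}"
      have "cmod (p i * of_nat (m - i) + q i) \<le> B * real (m - i) + B * real i"
        using norm_triangle_ineq[of "p i * of_nat (m - i)" "q i"] q[of i]
          mult_right_mono[OF p[of i], of "real (m - i)"]
        by (simp add: norm_mult del: of_nat_diff)
      also have "\<dots> = B * real m"
        using i by (simp add: algebra_simps)
      finally show "cmod ((p i * of_nat (m - i) + q i) * g (m - i)) \<le> B * real m * cmod (g (m - i))"
        by (simp add: norm_mult mult_right_mono)
    qed
    also have "\<dots> = B * real m * S n"
    proof -
      have "(\<Sum>i=1..m. cmod (g (m - i))) = S n"
        unfolding S_def m_def
        by (rule sum.reindex_bij_witness[of _ "\<lambda>k. Suc n - k" "\<lambda>i. Suc n - i"]) auto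
      then show ?thesis by (simp only: sum_distrib_left[symmetric])
    qed
    finally have le: "cmod (\<Sum>i=1..m. (p i * of_nat (m - i) + q i) * g (m - i)) \<le> B * real m * S n" .
    have "g m = (\<Sum>i=1..m. (p i * of_nat (m - i) + q i) * g (m - i)) / (of_nat m * (of_nat n + c))"
      unfolding g_def using m by (subst frobenius.simps) simp
    then have "cmod (g m) = cmod (\<Sum>i=1..m. (p i * of_nat (m - i) + q i) * g (m - i)) /
        (real m * cmod (of_nat n + c))"
      by (simp add: norm_divide norm_mult)
    also have "\<dots> \<le> B * real m * S n / (real m * cmod (of_nat n + c))"
      by (intro divide_right_mono le) simp
    also have "\<dots> = B * S n * inverse (cmod (of_nat n + c))"
      using m by (simp add: field_simps)
    also have "inverse (cmod (of_nat n + c)) = cmod (inverse (1 + (c - 1) / of_nat m)) / real m"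
    proof -
      have "1 + (c - 1) / of_nat m = (of_nat n + c) / of_nat m"
        using m by (simp add: field_simps flip: m(3))
      then show ?thesis using m by (simp add: norm_divide norm_inverse inverse_eq_divide)
    qed
    also have "B * S n * (cmod (inverse (1 + (c - 1) / of_nat m)) / real m) \<le> B * S n * (D / real m)"
      by (intro mult_left_mono divide_right_mono D mult_nonneg_nonneg B0 S0) simp
    finally show ?thesis by (simp add: mult_ac m_def)
  qed
  define c' where "c' = (1 + r) / 2"
  have c': "r < c'" "c' < 1" using r by (auto simp: c'_def)
  have "(\<lambda>n. r * (1 + D * B / real (Suc n))) \<longlonglongrightarrow> r * (1 + 0)"
    by (intro tendsto_intros LIMSEQ_Suc[OF lim_const_over_n])
  then have "eventually (\<lambda>n. r * (1 + D * B / real (Suc n)) < c') sequentially"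
    using c' by (intro order_tendstoD) auto
  then obtain N where N: "\<And>n. n \<ge> N \<Longrightarrow> r * (1 + D * B / real (Suc n)) < c'"
    by (auto simp: eventually_sequentially)
  have "summable (\<lambda>n. S n * r ^ n)"
  proof (rule summable_ratio_test[OF c'(2), of N])
    fix n assume n: "n \<ge> N"
    have "S (Suc n) \<le> S n * (1 + D * B / real (Suc n))"
      using g_le[of n] by (simp add: S_def algebra_simps)
    then have "S (Suc n) * r ^ Suc n \<le> S n * (1 + D * B / real (Suc n)) * r ^ Suc n"
      using r by (intro mult_right_mono) auto
    also have "\<dots> = (r * (1 + D * B / real (Suc n))) * (S n * r ^ n)" by simp
    also have "\<dots> \<le> c' * (S n * r ^ n)"
      using N[OF n] r S0 by (intro mult_right_mono) auto
    finally show "norm (S (Suc n) * r ^ Suc n) \<le> c' * norm (S n * r ^ n)"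
      using S0[of n] S0[of "Suc n"] r by simp
  qed
  then show ?thesis
  proof (rule summable_comparison_test'[where N = 0])
    fix n
    have "cmod (g n) \<le> S n" unfolding S_def by (intro member_le_sum) auto
    then show "norm (cmod (frobenius p q c n) * r ^ n) \<le> S n * r ^ n"
      using r by (simp add: g_def mult_right_mono)
  qed
qed

lemma frobenius_conv_radius:
  assumes c: "\<And>n. c \<noteq> - of_nat n"
    and p: "\<And>k. cmod (p k) \<le> B" and q: "\<And>k. cmod (q k) \<le> B * real k"
  shows "fps_conv_radius (Abs_fps (frobenius p q c)) \<ge> 1"
  unfolding fps_conv_radius_def
proof (rule conv_radius_geI_ex')
  fix r :: real assume r: "0 < r" "ereal r < 1"
  have "summable (\<lambda>n. cmod (frobenius p q c n) * r ^ n)"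
    using r by (intro frobenius_summable[OF c p q]) auto
  also have "(\<lambda>n. cmod (frobenius p q c n) * r ^ n) = (\<lambda>n. norm (frobenius p q c n * of_real r ^ n))"
    using r by (simp add: norm_mult norm_power)
  finally show "summable (\<lambda>n. fps_nth (Abs_fps (frobenius p q c)) n * of_real r ^ n)"
    using summable_norm_cancel by (simp only: fps_nth_Abs_fps)
qed

lemma frobenius_fps_ode:
  assumes c: "\<And>n. c \<noteq> - of_nat n" and pq: "p 0 = 0" "q 0 = 0"
  defines "g \<equiv> Abs_fps (frobenius p q c)"
  shows "fps_X * fps_deriv (fps_X * fps_deriv g) + fps_const (c - 1) * (fps_X * fps_deriv g) =
         Abs_fps p * (fps_X * fps_deriv g) + Abs_fps q * g"
proof (rule fps_ext)
  fix n
  have th: "fps_nth (fps_X * fps_deriv f) m = of_nat m * fps_nth f m" for f :: "complex fps" and m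
    by (cases m) auto
  have "fps_nth (Abs_fps p * (fps_X * fps_deriv g) + Abs_fps q * g) n =
      (\<Sum>i=0..n. (p i * of_nat (n - i) + q i) * frobenius p q c (n - i))"
    unfolding fps_add_nth fps_mult_nth[of "Abs_fps _"] th
    by (simp add: g_def sum.distrib algebra_simps del: of_nat_diff)
  also have "\<dots> = of_nat n * (of_nat n - 1 + c) * frobenius p q c n"
    using frobenius_rec[of c p q n] assms by simp
  also have "\<dots> = fps_nth (fps_X * fps_deriv (fps_X * fps_deriv g) + fps_const (c - 1) * (fps_X * fps_deriv g)) n"
    unfolding fps_add_nth fps_mult_left_const_nth th by (simp add: g_def algebra_simps)
  finally show "fps_nth (fps_X * fps_deriv (fps_X * fps_deriv g) + fps_const (c - 1) * (fps_X * fps_deriv g)) n =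
     fps_nth (Abs_fps p * (fps_X * fps_deriv g) + Abs_fps q * g) n" ..
qed

section \<open>The hypergeometric equation on the slit plane\<close>

text \<open>
  Substituting \<open>z = 4w/(1 + w)\<^sup>2\<close> into the hypergeometric equation gives an equation of Frobenius type with
  \<open>P = u w/(1 - w) - v w/(1 + w)\<close> and \<open>Q = 4ab w/(1 + w)\<^sup>2\<close>, where \<open>u = 2(a + b) + 1 - 2c\<close> and
  \<open>v = 1 - 2(a + b)\<close>. Multiplying by \<open>(1 - w)(1 + w)\<^sup>2\<close> leaves polynomial coefficients.
\<close>

lemma uniformised_hypergeometric_series:
  fixes a b c :: complex
  assumes c: "\<And>n. c \<noteq> - of_nat n"
  defines "s \<equiv> a + b"
  obtains g :: "complex fps" where "fps_conv_radius g \<ge> 1" "fps_nth g 0 = 1"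
    "(1 - fps_X) * (1 + fps_X)\<^sup>2 *
      (fps_X * fps_deriv (fps_X * fps_deriv g) + fps_const (c - 1) * (fps_X * fps_deriv g)) =
     (fps_const (2 * s + 1 - 2 * c) * fps_X * (1 + fps_X)\<^sup>2 -
      fps_const (1 - 2 * s) * fps_X * (1 - fps_X) * (1 + fps_X)) * (fps_X * fps_deriv g) +
     fps_const (4 * a * b) * fps_X * (1 - fps_X) * g"
proof -
  define u where "u = 2 * s + 1 - 2 * c"
  define v where "v = 1 - 2 * s"
  define p :: "nat \<Rightarrow> complex" where "p = (\<lambda>k. if k = 0 then 0 else u + v * (-1) ^ k)"
  define q :: "nat \<Rightarrow> complex" where "q = (\<lambda>k. 4 * a * b * of_nat k * (-1) ^ (k - 1))"
  define g where "g = Abs_fps (frobenius p q c)"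
  define E N :: "complex fps" where "E = Abs_fps (\<lambda>_. 1)" and "N = Abs_fps (\<lambda>k. (-1) ^ k)"
  define B where "B = cmod u + cmod v + cmod (4 * a * b)"
  have p_le: "cmod (p k) \<le> B" for k
    using norm_triangle_ineq[of u "v * (-1) ^ k"]
    by (auto simp: p_def B_def norm_mult norm_power intro: add_increasing2)
  have q_le: "cmod (q k) \<le> B * real k" for k
    by (auto simp: q_def B_def norm_mult norm_power algebra_simps)
  \<comment> \<open>\<open>E\<close> and \<open>N\<close> are the geometric series of \<open>1/(1 - w)\<close> and \<open>1/(1 + w)\<close>.\<close>
  have E: "(1 - fps_X) * E = 1"
  proof (rule fps_ext)
    fix n show "fps_nth ((1 - fps_X) * E) n = fps_nth 1 n"
      by (cases n) (auto simp: E_def algebra_simps)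
  qed
  have N: "(1 + fps_X) * N = 1"
  proof (rule fps_ext)
    fix n show "fps_nth ((1 + fps_X) * N) n = fps_nth 1 n"
      by (cases n) (auto simp: N_def algebra_simps)
  qed
  have P: "Abs_fps p = fps_const u * fps_X * E - fps_const v * fps_X * N"
  proof (rule fps_ext)
    fix n show "fps_nth (Abs_fps p) n = fps_nth (fps_const u * fps_X * E - fps_const v * fps_X * N) n"
      by (cases n) (auto simp: E_def N_def p_def mult.assoc)
  qed
  have NN: "fps_nth (N * N) n = of_nat (n + 1) * (-1) ^ n" for n
  proof -
    have "fps_nth (N * N) n = (\<Sum>i=0..n. (-1) ^ i * (-1) ^ (n - i))"
      by (simp add: fps_mult_nth N_def)
    also have "\<dots> = (\<Sum>i=0..n. (-1) ^ n)"
      by (rule sum.cong) (auto simp flip: power_add)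
    finally show ?thesis by simp
  qed
  have Q: "Abs_fps q = fps_const (4 * a * b) * fps_X * (N * N)"
  proof (rule fps_ext)
    fix n show "fps_nth (Abs_fps q) n = fps_nth (fps_const (4 * a * b) * fps_X * (N * N)) n"
      using NN[of "n - 1"] by (cases n) (auto simp: q_def mult.assoc)
  qed
  let ?T = "fps_X * fps_deriv g"
  have ode: "fps_X * fps_deriv ?T + fps_const (c - 1) * ?T = Abs_fps p * ?T + Abs_fps q * g"
    unfolding g_def by (rule frobenius_fps_ode[OF c]) (auto simp: p_def q_def)
  have regroup: "x * y\<^sup>2 * ((k1 * X * E' - k2 * X * N') * T + k3 * X * (N' * N') * h) =
      (k1 * X * y\<^sup>2 * (x * E') - k2 * X * x * y * (y * N')) * T + k3 * X * x * (y * N') * (y * N') * h"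
    for x y k1 k2 k3 X E' N' T h :: "complex fps"
    by (simp add: algebra_simps power2_eq_square)
  have "(1 - fps_X) * (1 + fps_X)\<^sup>2 * (fps_X * fps_deriv ?T + fps_const (c - 1) * ?T) =
     (fps_const u * fps_X * (1 + fps_X)\<^sup>2 * ((1 - fps_X) * E) -
      fps_const v * fps_X * (1 - fps_X) * (1 + fps_X) * ((1 + fps_X) * N)) * ?T +
      fps_const (4 * a * b) * fps_X * (1 - fps_X) * ((1 + fps_X) * N) * ((1 + fps_X) * N) * g"
    unfolding ode P Q by (rule regroup)
  then have "(1 - fps_X) * (1 + fps_X)\<^sup>2 * (fps_X * fps_deriv ?T + fps_const (c - 1) * ?T) =
     (fps_const u * fps_X * (1 + fps_X)\<^sup>2 -
      fps_const v * fps_X * (1 - fps_X) * (1 + fps_X)) * ?T +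
     fps_const (4 * a * b) * fps_X * (1 - fps_X) * g"
    unfolding E N by simp
  moreover have "fps_conv_radius g \<ge> 1"
    unfolding g_def by (rule frobenius_conv_radius[OF c p_le q_le])
  moreover have "fps_nth g 0 = 1" by (simp add: g_def)
  ultimately show ?thesis using that unfolding u_def v_def by blast
qed

lemma uniformised_hypergeometric_function:
  fixes a b c :: complex
  assumes c: "\<And>n. c \<noteq> - of_nat n"
  obtains G G1 G2 :: "complex \<Rightarrow> complex" where "G 0 = 1"
    "\<And>w. cmod w < 1 \<Longrightarrow> (G has_field_derivative G1 w) (at w)"
    "\<And>w. cmod w < 1 \<Longrightarrow> (G1 has_field_derivative G2 w) (at w)"
    "\<And>w. cmod w < 1 \<Longrightarrow> (1 - w) * (1 + w)\<^sup>2 * (w * (G1 w + w * G2 w) + (c - 1) * (w * G1 w)) =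
      ((2 * (a + b) + 1 - 2 * c) * w * (1 + w)\<^sup>2 - (1 - 2 * (a + b)) * w * (1 - w) * (1 + w)) * (w * G1 w) +
      4 * a * b * w * (1 - w) * G w"
proof -
  obtain g :: "complex fps" where g: "fps_conv_radius g \<ge> 1" "fps_nth g 0 = 1" and
    ode: "(1 - fps_X) * (1 + fps_X)\<^sup>2 *
      (fps_X * fps_deriv (fps_X * fps_deriv g) + fps_const (c - 1) * (fps_X * fps_deriv g)) =
     (fps_const (2 * (a + b) + 1 - 2 * c) * fps_X * (1 + fps_X)\<^sup>2 -
      fps_const (1 - 2 * (a + b)) * fps_X * (1 - fps_X) * (1 + fps_X)) * (fps_X * fps_deriv g) +
     fps_const (4 * a * b) * fps_X * (1 - fps_X) * g"
    using uniformised_hypergeometric_series[OF c, of a b] by blast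
  have ode': "(1 - fps_X) * (1 + fps_X)\<^sup>2 *
      (fps_X * (fps_deriv g + fps_X * fps_deriv (fps_deriv g)) + fps_const (c - 1) * (fps_X * fps_deriv g)) =
     (fps_const (2 * (a + b) + 1 - 2 * c) * fps_X * (1 + fps_X)\<^sup>2 -
      fps_const (1 - 2 * (a + b)) * fps_X * (1 - fps_X) * (1 + fps_X)) * (fps_X * fps_deriv g) +
     fps_const (4 * a * b) * fps_X * (1 - fps_X) * g"
    using ode by (simp add: add.commute)
  have R: "fps_conv_radius (f + h) \<ge> 1" "fps_conv_radius (f - h) \<ge> 1" "fps_conv_radius (f * h) \<ge> 1"
    if "fps_conv_radius f \<ge> 1" "fps_conv_radius h \<ge> 1" for f h :: "complex fps"
    using that fps_conv_radius_add[of f h] fps_conv_radius_diff[of f h] fps_conv_radius_mult[of f h]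
    by (meson min.boundedI order_trans)+
  have R': "fps_conv_radius (fps_deriv f) \<ge> 1" "fps_conv_radius (f\<^sup>2) \<ge> 1"
    if "fps_conv_radius f \<ge> 1" for f :: "complex fps"
    using that fps_conv_radius_deriv[of f] fps_conv_radius_power[of f 2] order_trans by blast+
  have lt: "ereal (norm w) < fps_conv_radius f" if "fps_conv_radius f \<ge> 1" "cmod w < 1"
    for f :: "complex fps" and w
    using that by (meson ereal_less(3) less_le_trans)
  have ev: "eval_fps (f + h) w = eval_fps f w + eval_fps h w"
     "eval_fps (f - h) w = eval_fps f w - eval_fps h w"
     "eval_fps (f * h) w = eval_fps f w * eval_fps h w"
    if "fps_conv_radius f \<ge> 1" "fps_conv_radius h \<ge> 1" "cmod w < 1" for f h :: "complex fps" and w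
    using that by (simp_all add: eval_fps_add eval_fps_diff eval_fps_mult lt)
  have ev2: "eval_fps (f\<^sup>2) w = (eval_fps f w)\<^sup>2"
    if "fps_conv_radius f \<ge> 1" "cmod w < 1" for f :: "complex fps" and w
    using that by (simp add: eval_fps_power lt)
  show ?thesis
  proof (rule that[of "eval_fps g" "eval_fps (fps_deriv g)" "eval_fps (fps_deriv (fps_deriv g))"])
    show "eval_fps g 0 = 1" by (simp add: eval_fps_at_0 g)
    fix w :: complex assume w: "cmod w < 1"
    show "(eval_fps g has_field_derivative eval_fps (fps_deriv g) w) (at w)"
      "(eval_fps (fps_deriv g) has_field_derivative eval_fps (fps_deriv (fps_deriv g)) w) (at w)"
      using has_field_derivative_eval_fps[OF lt[OF _ w], of g]
        has_field_derivative_eval_fps[OF lt[OF _ w], of "fps_deriv g"] g(1) R'(1)[OF g(1)] by auto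
    show "(1 - w) * (1 + w)\<^sup>2 * (w * (eval_fps (fps_deriv g) w + w * eval_fps (fps_deriv (fps_deriv g)) w) +
        (c - 1) * (w * eval_fps (fps_deriv g) w)) =
      ((2 * (a + b) + 1 - 2 * c) * w * (1 + w)\<^sup>2 - (1 - 2 * (a + b)) * w * (1 - w) * (1 + w)) * (w * eval_fps (fps_deriv g) w) +
      4 * a * b * w * (1 - w) * eval_fps g w"
      using arg_cong[OF ode', of "\<lambda>f. eval_fps f w"] w g(1)
      by (simp add: ev ev2 R R' del: fps_const_add fps_const_mult fps_const_sub)
  qed
qed

lemma open_slit_plane: "open slit_plane"
  unfolding slit_plane_def
  by (intro open_Compl closed_injective_image_subspace closed_slot_right)

lemma zero_in_slit_plane [simp]: "0 \<in> slit_plane"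
  by (auto simp: slit_plane_def)

lemma slit_plane_csqrt:
  assumes "z \<in> slit_plane"
  shows "1 - z \<notin> \<real>\<^sub>\<le>\<^sub>0" "Re (csqrt (1 - z)) > 0"
proof -
  show *: "1 - z \<notin> \<real>\<^sub>\<le>\<^sub>0"
  proof
    assume "1 - z \<in> \<real>\<^sub>\<le>\<^sub>0"
    then obtain x where "x \<le> 0" "1 - z = of_real x" by (auto elim: nonpos_Reals_cases)
    then have "z = of_real (1 - x)" "1 - x \<in> {1..}" by (auto simp: algebra_simps)
    then show False using assms unfolding slit_plane_def by blast
  qed
  have "Re (csqrt (1 - z)) \<noteq> 0"
  proof
    assume "Re (csqrt (1 - z)) = 0"
    then have "(csqrt (1 - z))\<^sup>2 = of_real (- (Im (csqrt (1 - z)))\<^sup>2)"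
      by (simp only: complex_eq_iff) (simp add: power2_eq_square del: csqrt.sel)
    then have "1 - z = of_real (- (Im (csqrt (1 - z)))\<^sup>2)" by (simp only: power2_csqrt)
    then show False using * by (metis nonpos_Reals_of_real_iff neg_le_0_iff_le zero_le_power2)
  qed
  then show "Re (csqrt (1 - z)) > 0"
    using Re_csqrt[of "1 - z"] by linarith
qed

lemma cayley_less_1:
  assumes "Re r > 0"
  shows "cmod ((1 - r) / (1 + r)) < 1"
proof -
  have "(cmod (1 - r))\<^sup>2 < (cmod (1 + r))\<^sup>2"
    using assms unfolding cmod_power2 by (simp add: power2_eq_square algebra_simps)
  then have "cmod (1 - r) < cmod (1 + r)"
    by (rule power2_less_imp_less) simp
  then show ?thesis by (simp add: norm_divide divide_less_eq)
qed

text \<open>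
  The change of variable read backwards, in terms of \<open>r = sqrt (1 - z)\<close>, for which \<open>z = 1 - r\<^sup>2\<close> and
  \<open>w = (1 - r)/(1 + r)\<close>. Here \<open>h1\<close> and \<open>h2\<close> are the first two \<open>z\<close>-derivatives of \<open>G(w(z))\<close> by the chain rule,
  since \<open>dw/dz = 1/(r (1 + r)\<^sup>2)\<close>.
\<close>

lemma koebe_change_of_variable:
  fixes r a b c G G1 G2 :: complex
  assumes r: "r \<noteq> 0" "1 + r \<noteq> 0"
    and w: "w = (1 - r) / (1 + r)"
    and ode: "(1 - w) * (1 + w)\<^sup>2 * (w * (G1 + w * G2) + (c - 1) * (w * G1)) =
      ((2 * (a + b) + 1 - 2 * c) * w * (1 + w)\<^sup>2 - (1 - 2 * (a + b)) * w * (1 - w) * (1 + w)) * (w * G1) +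
      4 * a * b * w * (1 - w) * G"
  defines "h1 \<equiv> G1 / (r * (1 + r)\<^sup>2)"
    and "h2 \<equiv> G2 / (r * (1 + r)\<^sup>2)\<^sup>2 + G1 * ((1 + 3 * r) / (2 * r ^ 3 * (1 + r) ^ 3))"
  shows "(1 - r\<^sup>2) * ((1 - r\<^sup>2) * r\<^sup>2 * h2 + (c - (a + b + 1) * (1 - r\<^sup>2)) * h1 - a * b * G) = 0"
proof -
  have e: "1 - w = 2 * r / (1 + r)" "1 + w = 2 / (1 + r)"
    using r(2) unfolding w by (simp_all add: field_simps)
  show ?thesis
    using ode r unfolding e h1_def h2_def
    unfolding w
    by (simp add: divide_simps) algebra
qed

text \<open>
  The branch of \<open>sqrt (1 - z)\<close> with positive real part is holomorphic on the slit plane, and the Cayley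
  transform sends the right half-plane into the unit disc. So \<open>G((1 - r)/(1 + r))\<close> is defined on the
  whole slit plane. The equation is stated with an extra factor \<open>z\<close> because the equation in \<open>w\<close> is
  degenerate at \<open>w = 0\<close>.
\<close>

lemma hypergeometric_continuation_ode:
  fixes a b c :: complex
  assumes c: "\<And>n. c \<noteq> - of_nat n"
  obtains h h1 h2 :: "complex \<Rightarrow> complex" where "h 0 = 1"
    "\<And>z. z \<in> slit_plane \<Longrightarrow> (h has_field_derivative h1 z) (at z)"
    "\<And>z. z \<in> slit_plane \<Longrightarrow> (h1 has_field_derivative h2 z) (at z)"
    "\<And>z. z \<in> slit_plane \<Longrightarrow>
       z * (z * (1 - z) * h2 z + (c - (a + b + 1) * z) * h1 z - a * b * h z) = 0"
proof -
  obtain G G1 G2 where G0: "G 0 = 1"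
    and G: "\<And>w. cmod w < 1 \<Longrightarrow> (G has_field_derivative G1 w) (at w)"
    "\<And>w. cmod w < 1 \<Longrightarrow> (G1 has_field_derivative G2 w) (at w)"
    and ode: "\<And>w. cmod w < 1 \<Longrightarrow> (1 - w) * (1 + w)\<^sup>2 * (w * (G1 w + w * G2 w) + (c - 1) * (w * G1 w)) =
      ((2 * (a + b) + 1 - 2 * c) * w * (1 + w)\<^sup>2 - (1 - 2 * (a + b)) * w * (1 - w) * (1 + w)) * (w * G1 w) +
      4 * a * b * w * (1 - w) * G w"
    using uniformised_hypergeometric_function[OF c, of a b] by blast
  define r where "r z = csqrt (1 - z)" for z
  define \<psi> where "\<psi> z = (1 - r z) / (1 + r z)" for z
  define \<kappa> where "\<kappa> z = 1 / (r z * (1 + r z)\<^sup>2)" for z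
  define \<kappa>' where "\<kappa>' z = (1 + 3 * r z) / (2 * r z ^ 3 * (1 + r z) ^ 3)" for z
  have nz: "r z \<noteq> 0" "1 + r z \<noteq> 0" if "z \<in> slit_plane" for z
    using slit_plane_csqrt(2)[OF that] by (auto simp: r_def complex_eq_iff simp del: csqrt.sel)
  have \<psi>: "cmod (\<psi> z) < 1" if "z \<in> slit_plane" for z
    unfolding \<psi>_def r_def by (rule cayley_less_1[OF slit_plane_csqrt(2)[OF that]])
  have Dr: "(r has_field_derivative (- 1 / (2 * r z))) (at z)" if "z \<in> slit_plane" for z
    unfolding r_def by (rule derivative_eq_intros refl slit_plane_csqrt that | simp)+
  have D\<psi>: "(\<psi> has_field_derivative \<kappa> z) (at z)" if "z \<in> slit_plane" for z
    unfolding \<psi>_def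
    apply (rule derivative_eq_intros refl Dr[OF that] nz(2)[OF that])+
    using nz[OF that] by (simp add: \<kappa>_def divide_simps) algebra
  have D\<kappa>: "(\<kappa> has_field_derivative \<kappa>' z) (at z)" if "z \<in> slit_plane" for z
  proof -
    let ?r = "r z"
    have den: "((\<lambda>x. x * (1 + x)\<^sup>2) has_field_derivative (1 + ?r) * (1 + 3 * ?r)) (at ?r)"
      by (rule derivative_eq_intros refl)+ (simp add: algebra_simps power2_eq_square)
    have "((\<lambda>x. inverse (x * (1 + x)\<^sup>2)) has_field_derivative
        - ((1 + ?r) * (1 + 3 * ?r)) / (?r * (1 + ?r)\<^sup>2)\<^sup>2) (at ?r)"
      using DERIV_inverse_fun[OF den] nz[OF that]
      by (simp add: divide_inverse power2_eq_square mult_ac)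
    from DERIV_chain2[OF this Dr[OF that]]
    have "(\<kappa> has_field_derivative
        - ((1 + ?r) * (1 + 3 * ?r)) / (?r * (1 + ?r)\<^sup>2)\<^sup>2 * (- 1 / (2 * ?r))) (at z)"
      unfolding \<kappa>_def by (simp add: inverse_eq_divide)
    also have "- ((1 + ?r) * (1 + 3 * ?r)) / (?r * (1 + ?r)\<^sup>2)\<^sup>2 * (- 1 / (2 * ?r)) = \<kappa>' z"
      using nz[OF that] by (simp add: \<kappa>'_def power2_eq_square power3_eq_cube)
    finally show ?thesis .
  qed
  show ?thesis
  proof (rule that[of "\<lambda>z. G (\<psi> z)" "\<lambda>z. G1 (\<psi> z) * \<kappa> z"
        "\<lambda>z. G2 (\<psi> z) * \<kappa> z * \<kappa> z + G1 (\<psi> z) * \<kappa>' z"])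
    show "G (\<psi> 0) = 1" by (simp add: \<psi>_def r_def G0)
    fix z assume z: "z \<in> slit_plane"
    show "((\<lambda>z. G (\<psi> z)) has_field_derivative G1 (\<psi> z) * \<kappa> z) (at z)"
      by (rule DERIV_chain2[OF G(1)[OF \<psi>[OF z]] D\<psi>[OF z]])
    show "((\<lambda>z. G1 (\<psi> z) * \<kappa> z) has_field_derivative
        G2 (\<psi> z) * \<kappa> z * \<kappa> z + G1 (\<psi> z) * \<kappa>' z) (at z)"
      using DERIV_mult[OF DERIV_chain2[OF G(2)[OF \<psi>[OF z]] D\<psi>[OF z]] D\<kappa>[OF z]]
      by (simp add: mult_ac add_ac)
    have zr: "z = 1 - (r z)\<^sup>2" by (simp add: r_def)
    have "1 - z = (r z)\<^sup>2" by (simp add: r_def)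
    with koebe_change_of_variable[OF nz[OF z] \<psi>_def ode[OF \<psi>[OF z]]]
    show "z * (z * (1 - z) * (G2 (\<psi> z) * \<kappa> z * \<kappa> z + G1 (\<psi> z) * \<kappa>' z) +
        (c - (a + b + 1) * z) * (G1 (\<psi> z) * \<kappa> z) - a * b * G (\<psi> z)) = 0"
      unfolding zr[symmetric] by (simp add: \<kappa>_def \<kappa>'_def power2_eq_square mult_ac)
  qed
qed

text \<open>
  The hypergeometric equation forces the recursion
  \<open>(n + 1)(c + n) f\<^sub>n\<^sub>+\<^sub>1 = (a + n)(b + n) f\<^sub>n\<close> on the Taylor coefficients at \<open>0\<close>; as \<open>c\<close> is not a
  nonpositive integer, it determines them from the value at \<open>0\<close>.
\<close>

lemma hypergeometric_series_unique:
  fixes a b c :: complex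
  assumes c: "\<And>n. c \<noteq> - of_nat n"
    and h: "h holomorphic_on slit_plane" "h 0 = 1"
    and ode: "\<And>z. z \<in> slit_plane \<Longrightarrow>
       z * (z * (1 - z) * deriv (deriv h) z + (c - (a + b + 1) * z) * deriv h z - a * b * h z) = 0"
  shows "is_hyp2F1 a b c h"
proof -
  define f where "f = fps_expansion h 0"
  have hf: "h has_fps_expansion f"
    unfolding f_def by (rule has_fps_expansion_fps_expansion[OF open_slit_plane _ h(1)]) simp
  let ?X = "fps_X :: complex fps"
  let ?F = "?X * (?X * (1 - ?X) * fps_deriv (fps_deriv f) +
      (fps_const c - fps_const (a + b + 1) * ?X) * fps_deriv f - fps_const (a * b) * f)"
  have "(\<lambda>z. z * (z * (1 - z) * deriv (deriv h) z + (c - (a + b + 1) * z) * deriv h z - a * b * h z))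
      has_fps_expansion ?F"
    by (intro fps_expansion_intros hf)
  moreover have "eventually (\<lambda>z. z * (z * (1 - z) * deriv (deriv h) z +
      (c - (a + b + 1) * z) * deriv h z - a * b * h z) = 0) (nhds 0)"
    using eventually_nhds_in_open[OF open_slit_plane zero_in_slit_plane]
    by eventually_elim (rule ode)
  then have "(\<lambda>z. z * (z * (1 - z) * deriv (deriv h) z + (c - (a + b + 1) * z) * deriv h z - a * b * h z))
      has_fps_expansion 0"
    by (simp only: has_fps_expansion_0_iff)
  \<comment> \<open>The ring of formal power series is a domain, so the degenerate factor \<open>z\<close> can be cancelled here.\<close>
  ultimately have "?F = 0" by (rule fps_expansion_unique_complex)
  then have F: "?X * (1 - ?X) * fps_deriv (fps_deriv f) +
      (fps_const c - fps_const (a + b + 1) * ?X) * fps_deriv f - fps_const (a * b) * f = 0"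
    by simp
  have rec: "of_nat (Suc n) * (c + of_nat n) * fps_nth f (Suc n) = (a + of_nat n) * (b + of_nat n) * fps_nth f n" for n
  proof (cases n)
    case 0
    then show ?thesis
      using arg_cong[OF F, of "\<lambda>f. fps_nth f n"] by (simp add: algebra_simps)
  next
    case (Suc m)
    then show ?thesis
      using arg_cong[OF F, of "\<lambda>f. fps_nth f n"]
      by (cases m) (simp_all add: algebra_simps)
  qed
  have "fps_nth f n = fps_nth (fps_hypergeo [a, b] [c] 1) n" for n
  proof (induction n)
    case 0
    have "fps_nth f 0 = 1" using hf h(2) fps_nth_fps_expansion[OF hf, of 0] by simp
    then show ?case by (simp del: fps_hypergeo_nth)
  next
    case (Suc n)
    have "of_nat (Suc n) \<noteq> (0::complex)" "c + of_nat n \<noteq> 0"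
      using c[of n] by (auto simp: add_eq_0_iff2 simp del: of_nat_Suc)
    then have "fps_nth f (Suc n) = (a + of_nat n) * (b + of_nat n) / (of_nat (Suc n) * (c + of_nat n)) * fps_nth f n"
      using rec[of n] by (simp add: nonzero_eq_divide_eq mult_ac del: of_nat_Suc)
    then show ?case
      unfolding Suc fps_hypergeo_rec by (simp del: of_nat_Suc fps_hypergeo_nth)
  qed
  then have f: "f = fps_hypergeo [a, b] [c] 1" by (rule fps_ext)
  have "ball 0 1 \<subseteq> slit_plane" by (auto simp: slit_plane_def)
  then have "h holomorphic_on eball 0 1"
    using h(1) holomorphic_on_subset by (metis one_ereal_def eball_ereal)
  then show ?thesis
    unfolding is_hyp2F1_def using h(1) eval_fps_expansion'[of h 0 1]
    by (auto simp: f_def[symmetric] f[symmetric])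
qed

lemma hyp2F1_ode:
  fixes a b c :: complex
  assumes c: "\<And>n. c \<noteq> - of_nat n"
  obtains h1 h2 :: "complex \<Rightarrow> complex" where "hyp2F1 a b c 0 = 1"
    "\<And>z. z \<in> slit_plane \<Longrightarrow> (hyp2F1 a b c has_field_derivative h1 z) (at z)"
    "\<And>z. z \<in> slit_plane \<Longrightarrow> (h1 has_field_derivative h2 z) (at z)"
    "\<And>z. z \<in> slit_plane \<Longrightarrow> z \<noteq> 0 \<Longrightarrow>
       z * (1 - z) * h2 z + (c - (a + b + 1) * z) * h1 z = a * b * hyp2F1 a b c z"
proof -
  obtain h h1 h2 where h: "h 0 = 1"
    "\<And>z. z \<in> slit_plane \<Longrightarrow> (h has_field_derivative h1 z) (at z)"
    "\<And>z. z \<in> slit_plane \<Longrightarrow> (h1 has_field_derivative h2 z) (at z)"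
    "\<And>z. z \<in> slit_plane \<Longrightarrow>
       z * (z * (1 - z) * h2 z + (c - (a + b + 1) * z) * h1 z - a * b * h z) = 0"
    using hypergeometric_continuation_ode[OF c, of a b] by blast
  have holo: "h holomorphic_on slit_plane"
    using h(2) by (auto simp: holomorphic_on_open[OF open_slit_plane])
  have d1: "deriv h z = h1 z" if "z \<in> slit_plane" for z
    using h(2)[OF that] by (rule DERIV_imp_deriv)
  have d2: "deriv (deriv h) z = h2 z" if "z \<in> slit_plane" for z
  proof -
    have "(deriv h has_field_derivative h2 z) (at z)"
      by (rule has_field_derivative_transform_within_open[OF h(3)[OF that] open_slit_plane that])
        (simp add: d1)
    then show ?thesis by (rule DERIV_imp_deriv)
  qed
  have "is_hyp2F1 a b c h"
    using h(4) d1 d2 by (intro hypergeometric_series_unique[OF c holo h(1)]) simp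
  then have eq: "hyp2F1 a b c z = h z" if "z \<in> slit_plane" for z
    using hyp2F1_eq that by blast
  show ?thesis
  proof (rule that[of h1 h2])
    show "hyp2F1 a b c 0 = 1" using eq[of 0] h(1) by simp
    fix z assume z: "z \<in> slit_plane"
    show "(hyp2F1 a b c has_field_derivative h1 z) (at z)"
      by (rule has_field_derivative_transform_within_open[OF h(2)[OF z] open_slit_plane z])
        (simp add: eq)
    show "(h1 has_field_derivative h2 z) (at z)" by (rule h(3)[OF z])
    show "z * (1 - z) * h2 z + (c - (a + b + 1) * z) * h1 z = a * b * hyp2F1 a b c z" if "z \<noteq> 0"
      using h(4)[OF z] that by (simp add: eq[OF z])
  qed
qed

section \<open>Calculus on the half-line\<close>

text \<open>
  The integrand is continued to negative arguments by its value at \<open>0\<close>, which makes the primitive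
  two-sided differentiable at the endpoint \<open>0\<close> as well.
\<close>

definition primitive :: "(real \<Rightarrow> real) \<Rightarrow> real \<Rightarrow> real" where
  "primitive f t = integral {-1..t} (\<lambda>x. f (max 0 x)) - integral {-1..0} (\<lambda>x. f (max 0 x))"

lemma primitive_0 [simp]: "primitive f 0 = 0"
  by (simp add: primitive_def)

lemma primitive_deriv:
  assumes f: "continuous_on {0..} f" and t: "t \<ge> 0"
  shows "(primitive f has_real_derivative f t) (at t)"
proof -
  let ?g = "\<lambda>x. f (max 0 x)"
  have "continuous_on {-1..t+1} ?g"
    by (rule continuous_on_compose2[OF f]) (auto intro!: continuous_intros)
  then have "((\<lambda>u. integral {-1..u} ?g) has_real_derivative ?g t) (at t within {-1..t+1})"
    using t by (intro integral_has_real_derivative) auto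
  moreover have "at t within {-1..t+1} = at t"
    using t by (intro at_within_interior) auto
  ultimately have "((\<lambda>u. integral {-1..u} ?g) has_real_derivative f t) (at t)"
    using t by (simp add: max_def)
  then show ?thesis
    unfolding primitive_def by (auto intro!: derivative_eq_intros)
qed

lemma primitive_continuous:
  assumes "continuous_on {0..} f"
  shows "continuous_on {0..} (primitive f)"
  using primitive_deriv[OF assms]
  by (intro continuous_at_imp_continuous_on) (auto intro: DERIV_isCont)

lemma mono_from_deriv:
  fixes f :: "real \<Rightarrow> real"
  assumes "continuous_on {0..} f"
    and "\<And>t. t > 0 \<Longrightarrow> (f has_real_derivative f' t) (at t)" "\<And>t. t > 0 \<Longrightarrow> f' t \<ge> 0"
    and "0 \<le> s" "s \<le> t"
  shows "f s \<le> f t"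
proof (rule DERIV_nonneg_imp_increasing_open[OF \<open>s \<le> t\<close>])
  show "continuous_on {s..t} f"
    by (rule continuous_on_subset[OF assms(1)]) (use assms in auto)
  fix x assume "s < x" "x < t"
  then show "\<exists>y. (f has_real_derivative y) (at x) \<and> 0 \<le> y"
    using assms(2,3)[of x] assms(4) by auto
qed

lemma norm_bound_from_deriv:
  fixes f :: "real \<Rightarrow> complex" and \<phi> :: "real \<Rightarrow> real"
  assumes "0 \<le> s" "s \<le> t" "continuous_on {0..} f" "continuous_on {s..t} \<phi>"
    and "\<And>x. s < x \<Longrightarrow> x < t \<Longrightarrow> (f has_vector_derivative f' x) (at x)"
    and "\<And>x. s < x \<Longrightarrow> x < t \<Longrightarrow> (\<phi> has_real_derivative \<phi>' x) (at x)"
    and "\<And>x. s < x \<Longrightarrow> x < t \<Longrightarrow> cmod (f' x) \<le> \<phi>' x"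
  shows "cmod (f t - f s) \<le> \<phi> t - \<phi> s"
proof (cases "s = t")
  case False
  show ?thesis
  proof (rule differentiable_bound_general)
    show "s < t" using False assms by simp
    show "continuous_on {s..t} f"
      by (rule continuous_on_subset[OF assms(3)]) (use assms in auto)
    show "(\<phi> has_vector_derivative \<phi>' x) (at x)" if "s < x" "x < t" for x
      using assms(6)[OF that] by (simp add: has_real_derivative_iff_has_vector_derivative)
  qed (use assms in auto)
qed auto

text \<open>
  The modulus of a vector-valued function need not be differentiable where the function vanishes;
  \<open>sqrt (\<bar>p\<bar>\<^sup>2 + \<epsilon>\<^sup>2)\<close> is a smooth substitute that differs from \<open>\<bar>p\<bar>\<close> by at most \<open>\<epsilon>\<close>.
\<close>

lemma smoothed_norm_deriv:
  fixes p :: "real \<Rightarrow> complex"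
  assumes "(p has_vector_derivative p') (at t)" "\<epsilon> > 0"
  shows "((\<lambda>t. sqrt ((cmod (p t))\<^sup>2 + \<epsilon>\<^sup>2)) has_real_derivative
    inner (p t) p' / sqrt ((cmod (p t))\<^sup>2 + \<epsilon>\<^sup>2)) (at t)"
proof -
  have "((\<lambda>t. inner (p t) (p t)) has_vector_derivative (inner (p t) p' + inner p' (p t))) (at t)"
    by (rule bounded_bilinear.has_vector_derivative[OF bounded_bilinear_inner assms(1) assms(1)])
  then have "((\<lambda>t. (cmod (p t))\<^sup>2) has_real_derivative 2 * inner (p t) p') (at t)"
    unfolding power2_norm_eq_inner has_real_derivative_iff_has_vector_derivative
    by (simp only: inner_commute[of p'] mult_2)
  then have *: "((\<lambda>t. (cmod (p t))\<^sup>2 + \<epsilon>\<^sup>2) has_real_derivative 2 * inner (p t) p' + 0) (at t)"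
    by (intro DERIV_add DERIV_const)
  have "(cmod (p t))\<^sup>2 + \<epsilon>\<^sup>2 > 0" using assms(2) by (simp add: add_nonneg_pos)
  from DERIV_chain2[OF DERIV_real_sqrt[OF this] *] show ?thesis
    by (simp add: inverse_eq_divide)
qed

section \<open>Radial operators of exponential growth\<close>

text \<open>
  The weight \<open>A\<close> and its logarithmic derivative \<open>a\<close> define the radial operator
  \<open>L u = u'' + a u' = (A u')' / A\<close>; the lower bound on \<open>a\<close> and the upper bound on \<open>A\<close> say that \<open>A\<close> grows like
  \<open>exp (2 \<rho> t)\<close>, and that \<open>A(t) exp (- 2 \<rho> t)\<close> increases to its limit.
\<close>

locale sturm_liouville_weight =
  fixes A a :: "real \<Rightarrow> real" and \<rho> :: real
  assumes rho_pos: "\<rho> > 0"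
    and A_cont: "continuous_on {0..} A" and A_0: "A 0 = 0"
    and A_pos: "t > 0 \<Longrightarrow> A t > 0"
    and A_deriv: "t > 0 \<Longrightarrow> (A has_real_derivative a t * A t) (at t)"
    and a_ge: "t > 0 \<Longrightarrow> a t \<ge> 2 * \<rho>"
    and A_le: "t > 0 \<Longrightarrow> A t \<le> exp (2 * \<rho> * t)"
begin

definition "I = primitive A"

text \<open>
  The solution of \<open>k' + a k = 2\<rho>\<close> that is regular at \<open>0\<close>. The quotient takes the right value \<open>0\<close> at \<open>t = 0\<close>
  because the denominator vanishes there and division by zero yields zero.
\<close>

definition "k t = 2 * \<rho> * I t / A t"

text \<open>
  The solution of \<open>L M = 2\<rho>\<close> with \<open>M(0) = M'(0) = 0\<close>; the lemma \<open>moment_derivative\<close> below identifies it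
  with the first moment.
\<close>

definition "M = primitive k"

lemma A_nonneg: "t \<ge> 0 \<Longrightarrow> A t \<ge> 0"
  using A_0 A_pos[of t] by (cases "t = 0") auto

lemma a_pos: "t > 0 \<Longrightarrow> a t > 0"
  using a_ge[of t] rho_pos by auto

lemma I_deriv: "t \<ge> 0 \<Longrightarrow> (I has_real_derivative A t) (at t)"
  unfolding I_def by (rule primitive_deriv[OF A_cont])

lemma I_cont: "continuous_on {0..} I"
  unfolding I_def by (rule primitive_continuous[OF A_cont])

lemma I_0 [simp]: "I 0 = 0" by (simp add: I_def)

lemma I_nonneg: assumes "t \<ge> 0" shows "I t \<ge> 0"
proof -
  have "I 0 \<le> I t"
    by (rule mono_from_deriv[where f' = A]) (simp_all add: assms I_cont I_deriv less_imp_le A_pos)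
  then show ?thesis by simp
qed

lemma I_le: assumes "t \<ge> 0" shows "2 * \<rho> * I t \<le> A t"
proof -
  have "A 0 - 2 * \<rho> * I 0 \<le> A t - 2 * \<rho> * I t"
  proof (rule mono_from_deriv[where f = "\<lambda>t. A t - 2 * \<rho> * I t" and f' = "\<lambda>t. (a t - 2 * \<rho>) * A t"])
    fix t :: real assume t: "t > 0"
    show "((\<lambda>t. A t - 2 * \<rho> * I t) has_real_derivative (a t - 2 * \<rho>) * A t) (at t)"
      using t by (auto intro!: derivative_eq_intros A_deriv I_deriv simp: algebra_simps)
    show "(a t - 2 * \<rho>) * A t \<ge> 0" using a_ge[OF t] A_pos[OF t] by simp
  qed (use assms in \<open>auto intro!: continuous_intros A_cont I_cont\<close>)
  then show ?thesis by (simp add: A_0)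
qed

lemma I_le_linear: assumes "t \<ge> 0" shows "I t \<le> t * A t"
proof -
  have "0 * A 0 - I 0 \<le> t * A t - I t"
  proof (rule mono_from_deriv[where f = "\<lambda>t. t * A t - I t" and f' = "\<lambda>t. t * (a t * A t)"])
    fix t :: real assume t: "t > 0"
    show "((\<lambda>t. t * A t - I t) has_real_derivative t * (a t * A t)) (at t)"
      using t by (auto intro!: derivative_eq_intros A_deriv I_deriv simp: algebra_simps)
    show "t * (a t * A t) \<ge> 0" using a_pos[OF t] A_pos[OF t] t by simp
  qed (use assms in \<open>auto intro!: continuous_intros A_cont I_cont\<close>)
  then show ?thesis by simp
qed

lemma k_0 [simp]: "k 0 = 0" by (simp add: k_def)

lemma k_nonneg: "t \<ge> 0 \<Longrightarrow> k t \<ge> 0"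
  unfolding k_def using I_nonneg A_nonneg rho_pos by simp

lemma k_le_1: assumes "t \<ge> 0" shows "k t \<le> 1"
proof (cases "t = 0")
  case False
  then have "A t > 0" using assms A_pos by simp
  then show ?thesis unfolding k_def using I_le[OF assms] by simp
qed simp

lemma k_le_linear: assumes "t \<ge> 0" shows "k t \<le> 2 * \<rho> * t"
proof (cases "t = 0")
  case False
  then have "A t > 0" using assms A_pos by simp
  then show ?thesis unfolding k_def using I_le_linear[OF assms] rho_pos
    by (simp add: divide_le_eq mult.assoc)
qed simp

lemma k_deriv: assumes "t > 0" shows "(k has_real_derivative 2 * \<rho> - a t * k t) (at t)"
proof -
  have nz: "A t \<noteq> 0" using A_pos[OF assms] by simp
  have "(k has_real_derivative ((2 * \<rho> * A t) * A t - (2 * \<rho> * I t) * (a t * A t)) / (A t * A t)) (at t)"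
    unfolding k_def using assms nz by (intro DERIV_divide DERIV_cmult A_deriv I_deriv) auto
  also have "((2 * \<rho> * A t) * A t - (2 * \<rho> * I t) * (a t * A t)) / (A t * A t) = 2 * \<rho> - a t * k t"
    using nz by (simp add: k_def field_simps)
  finally show ?thesis .
qed

lemma k_cont: "continuous_on {0..} k"
proof (rule continuous_on_eq_continuous_within[THEN iffD2], rule ballI)
  fix t :: real assume "t \<in> {0..}"
  then consider "t = 0" | "t > 0" by force
  then show "continuous (at t within {0..}) k"
  proof cases
    case 2
    then show ?thesis
      by (rule continuous_at_imp_continuous_within[OF DERIV_isCont[OF k_deriv]])
  next
    case 1
    have "(k \<longlongrightarrow> 0) (at 0 within {0..})"
    proof (rule tendsto_sandwich[of "\<lambda>_. 0" k _ "\<lambda>t. 2 * \<rho> * t"])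
      show "\<forall>\<^sub>F t in at 0 within {0..}. 0 \<le> k t" "\<forall>\<^sub>F t in at 0 within {0..}. k t \<le> 2 * \<rho> * t"
        using k_nonneg k_le_linear by (auto simp: eventually_at_filter)
      show "((\<lambda>t. 2 * \<rho> * t) \<longlongrightarrow> 0) (at 0 within {0..})"
        by (auto intro!: tendsto_eq_intros)
    qed auto
    then show ?thesis using 1 by (simp add: continuous_within)
  qed
qed

lemma M_deriv: "t \<ge> 0 \<Longrightarrow> (M has_real_derivative k t) (at t)"
  unfolding M_def by (rule primitive_deriv[OF k_cont])

lemma M_cont: "continuous_on {0..} M"
  unfolding M_def by (rule primitive_continuous[OF k_cont])

lemma M_0 [simp]: "M 0 = 0" by (simp add: M_def)

lemma M_mono: assumes "0 \<le> s" "s \<le> t" shows "M s \<le> M t"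
  by (rule mono_from_deriv[where f' = k]) (simp_all add: assms M_cont M_deriv k_nonneg)

lemma M_nonneg: "t \<ge> 0 \<Longrightarrow> M t \<ge> 0"
  using M_mono[of 0 t] by simp

text \<open>
  Since \<open>L f = r\<close> means \<open>(A f')' = A r\<close>, a bound \<open>N\<close> on \<open>r\<close> makes \<open>f\<close> at most \<open>N\<close> times the
  solution \<open>M/(2\<rho>)\<close> of the same problem with right-hand side \<open>1\<close>.
\<close>

lemma inhomogeneous_bound:
  fixes f df r :: "real \<Rightarrow> complex"
  assumes f: "f 0 = 0" "continuous_on {0..} f" "\<And>s. s > 0 \<Longrightarrow> (f has_vector_derivative df s) (at s)"
    and df: "continuous_on {0..} df"
      "\<And>s. s > 0 \<Longrightarrow> (df has_vector_derivative r s - a s * df s) (at s)"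
    and r: "\<And>s. 0 < s \<Longrightarrow> s < t \<Longrightarrow> cmod (r s) \<le> N"
    and t: "t \<ge> 0"
  shows "cmod (f t) \<le> N * M t / (2 * \<rho>)"
proof -
  have df_le: "cmod (df s) \<le> N * k s / (2 * \<rho>)" if s: "0 < s" "s < t" for s
  proof -
    have "cmod (A s *\<^sub>R df s - A 0 *\<^sub>R df 0) \<le> N * I s - N * I 0"
    proof (rule norm_bound_from_deriv[where f' = "\<lambda>x. A x *\<^sub>R r x" and \<phi>' = "\<lambda>x. N * A x"])
      show "continuous_on {0..} (\<lambda>x. A x *\<^sub>R df x)"
        by (intro continuous_intros A_cont df)
      show "continuous_on {0..s} (\<lambda>x. N * I x)"
        by (intro continuous_intros continuous_on_subset[OF I_cont]) auto
      fix x assume x: "0 < x" "x < s"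
      have "((\<lambda>x. A x *\<^sub>R df x) has_vector_derivative
          A x *\<^sub>R (r x - a x * df x) + (a x * A x) *\<^sub>R df x) (at x)"
        by (rule has_vector_derivative_scaleR[OF A_deriv[OF x(1)] df(2)[OF x(1)]])
      then show "((\<lambda>x. A x *\<^sub>R df x) has_vector_derivative A x *\<^sub>R r x) (at x)"
        by (simp add: scaleR_conv_of_real algebra_simps)
      show "((\<lambda>x. N * I x) has_real_derivative N * A x) (at x)"
        using x by (auto intro!: derivative_eq_intros I_deriv)
      show "cmod (A x *\<^sub>R r x) \<le> N * A x"
        using r[of x] x s A_pos[of x] by (simp add: mult.commute)
    qed (use s in auto)
    then have "A s * cmod (df s) \<le> N * I s"
      using A_pos[OF s(1)] by (simp add: A_0)
    then show ?thesis
      using A_pos[OF s(1)] rho_pos by (simp add: k_def field_simps)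
  qed
  have "cmod (f t - f 0) \<le> N / (2 * \<rho>) * M t - N / (2 * \<rho>) * M 0"
  proof (rule norm_bound_from_deriv[where f' = df and \<phi>' = "\<lambda>x. N / (2 * \<rho>) * k x"])
    show "continuous_on {0..t} (\<lambda>x. N / (2 * \<rho>) * M x)"
      by (intro continuous_intros continuous_on_subset[OF M_cont]) auto
    fix x assume x: "0 < x" "x < t"
    show "((\<lambda>x. N / (2 * \<rho>) * M x) has_real_derivative N / (2 * \<rho>) * k x) (at x)"
      using x by (intro DERIV_cmult M_deriv) simp
    show "cmod (df x) \<le> N / (2 * \<rho>) * k x" using df_le[OF x] by simp
  qed (use t f in auto)
  then show ?thesis using f(1) by simp
qed

text \<open>
  Solutions of \<open>L u = q u\<close> that are regular at the origin and normalised there; \<open>u1\<close> is the derivative of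
  \<open>u\<close>.
\<close>

definition eigenfunction :: "complex \<Rightarrow> (real \<Rightarrow> complex) \<Rightarrow> (real \<Rightarrow> complex) \<Rightarrow> bool" where
  "eigenfunction (q :: complex) u u1 \<longleftrightarrow> u 0 = (1 :: complex) \<and> u1 0 = (0 :: complex) \<and> continuous_on {0..} u \<and> continuous_on {0..} u1 \<and>
     (\<forall>t>0. (u has_vector_derivative u1 t) (at t)) \<and>
     (\<forall>t>0. (u1 has_vector_derivative q * u t - of_real (a t) * u1 t) (at t))"

text \<open>
  Apply the bound for the inhomogeneous equation twice: first to \<open>u - 1\<close>, whose right-hand side is \<open>q u\<close>
  (for small \<open>q\<close> this also bounds the maximum of \<open>\<bar>u\<bar>\<close> on \<open>[0, t]\<close> by \<open>2\<close>), then to \<open>u - 1 - q M/(2\<rho>)\<close>, whose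
  right-hand side is \<open>q (u - 1)\<close>.
\<close>

lemma eigenfunction_first_order:
  assumes u: "eigenfunction q u u1" and t: "t \<ge> 0"
    and small: "cmod q * M t / (2 * \<rho>) \<le> 1 / 2"
  shows "cmod (u t - 1 - q * M t / (2 * \<rho>)) \<le> (cmod q)\<^sup>2 * (M t)\<^sup>2 / (2 * \<rho>\<^sup>2)"
proof -
  note ef = u[unfolded eigenfunction_def]
  have "continuous_on {0..t} (\<lambda>s. cmod (u s))"
    using ef by (auto intro: continuous_on_subset intro!: continuous_on_norm)
  then obtain x where x: "x \<in> {0..t}" "\<And>s. s \<in> {0..t} \<Longrightarrow> cmod (u s) \<le> cmod (u x)"
    using continuous_attains_sup[of "{0..t}" "\<lambda>s. cmod (u s)"] t by auto
  define S where "S = cmod (u x)"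
  have dev: "cmod (u s - 1) \<le> cmod q * S * M t / (2 * \<rho>)" if s: "0 \<le> s" "s \<le> t" for s
  proof -
    have "cmod (u s - 1) \<le> (cmod q * S) * M s / (2 * \<rho>)"
    proof (rule inhomogeneous_bound[where df = u1 and r = "\<lambda>s. q * u s"])
      show "((\<lambda>s. u s - 1) has_vector_derivative u1 x) (at x)" if "x > 0" for x
        using ef that by (auto intro!: derivative_eq_intros)
      show "cmod (q * u x) \<le> cmod q * S" if "0 < x" "x < s" for x
        using x(2)[of x] that s by (auto simp: norm_mult S_def mult_left_mono)
    qed (use ef s in \<open>auto intro!: continuous_intros\<close>)
    also have "\<dots> \<le> cmod q * S * M t / (2 * \<rho>)"
      using M_mono[OF s] rho_pos by (intro divide_right_mono mult_left_mono) (auto simp: S_def)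
    finally show ?thesis .
  qed
  have "S \<le> 1 + cmod (u x - 1)"
    using norm_triangle_ineq[of "u x - 1" 1] by (simp add: S_def)
  also have "cmod (u x - 1) \<le> cmod q * S * M t / (2 * \<rho>)"
    using dev[of x] x(1) by auto
  also have "\<dots> = (cmod q * M t / (2 * \<rho>)) * S" by simp
  also have "\<dots> \<le> 1 / 2 * S" by (rule mult_right_mono[OF small]) (simp add: S_def)
  finally have S: "S \<le> 2" by simp
  have dev2: "cmod (u s - 1) \<le> cmod q * M t / \<rho>" if s: "0 \<le> s" "s \<le> t" for s
  proof -
    have "cmod q * S * M t / (2 * \<rho>) \<le> cmod q * 2 * M t / (2 * \<rho>)"
      using S M_nonneg[OF t] rho_pos by (intro divide_right_mono mult_left_mono mult_right_mono) auto
    then show ?thesis using dev[OF s] by simp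
  qed
  have "cmod (u t - 1 - q * M t / (2 * \<rho>)) \<le> (cmod q * (cmod q * M t / \<rho>)) * M t / (2 * \<rho>)"
  proof (rule inhomogeneous_bound[where df = "\<lambda>s. u1 s - q * k s / (2 * \<rho>)" and r = "\<lambda>s. q * (u s - 1)"])
    show "continuous_on {0..} (\<lambda>t. u t - 1 - q * M t / (2 * \<rho>))"
      using ef rho_pos by (intro continuous_intros M_cont) auto
    show "continuous_on {0..} (\<lambda>s. u1 s - q * k s / (2 * \<rho>))"
      using ef rho_pos by (intro continuous_intros k_cont) auto
    show "cmod (q * (u s - 1)) \<le> cmod q * (cmod q * M t / \<rho>)" if "0 < s" "s < t" for s
      using mult_left_mono[OF dev2[of s], of "cmod q"] that by (simp add: norm_mult)
    fix s :: real assume s: "s > 0"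
    have Dof: "((\<lambda>t. complex_of_real (g t)) has_vector_derivative of_real g') (at s)"
      if "(g has_real_derivative g') (at s)" for g g'
      by (rule has_vector_derivative_of_real[OF that])
    have DM: "((\<lambda>t. q * M t / (2 * \<rho>)) has_vector_derivative q * k s / (2 * \<rho>)) (at s)"
      using has_vector_derivative_mult_right[OF Dof[OF M_deriv[of s]], of "q / (2 * \<rho>)"] s by simp
    have Dk: "((\<lambda>t. q * k t / (2 * \<rho>)) has_vector_derivative q * (2 * \<rho> - a s * k s) / (2 * \<rho>)) (at s)"
      using has_vector_derivative_mult_right[OF Dof[OF k_deriv[of s]], of "q / (2 * \<rho>)"] s by simp
    show "((\<lambda>t. u t - 1 - q * M t / (2 * \<rho>)) has_vector_derivative u1 s - q * k s / (2 * \<rho>)) (at s)"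
      using has_vector_derivative_diff[OF has_vector_derivative_diff[OF _ has_vector_derivative_const] DM, of u "u1 s" 1] ef s
      by simp
    have "((\<lambda>t. u1 t - q * k t / (2 * \<rho>)) has_vector_derivative
        (q * u s - a s * u1 s) - q * (2 * \<rho> - a s * k s) / (2 * \<rho>)) (at s)"
      using ef s by (intro has_vector_derivative_diff Dk) auto
    also have "(q * u s - a s * u1 s) - q * (2 * \<rho> - a s * k s) / (2 * \<rho>) =
        q * (u s - 1) - a s * (u1 s - q * k s / (2 * \<rho>))"
      using rho_pos by (simp add: field_simps)
    finally show "((\<lambda>t. u1 t - q * k t / (2 * \<rho>)) has_vector_derivative
        q * (u s - 1) - a s * (u1 s - q * k s / (2 * \<rho>))) (at s)" .
  qed (use ef t in auto)
  then show ?thesis by (simp add: power2_eq_square mult_ac)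
qed

lemma ln_A_deriv: assumes "x > 0" shows "((\<lambda>x. ln (A x)) has_real_derivative a x) (at x)"
  using DERIV_chain2[OF DERIV_ln_divide[OF A_pos[OF assms]] A_deriv[OF assms]] A_pos[OF assms] by simp

text \<open>
  The eigenvalue \<open>l(2\<rho> + l)\<close> is \<open>2\<rho>l\<close> to first order, so the first-order term \<open>q M/(2\<rho>)\<close> of the
  eigenfunction becomes \<open>l M\<close>.
\<close>

lemma moment_derivative:
  fixes u u1 :: "complex \<Rightarrow> real \<Rightarrow> complex"
  assumes u: "\<And>l :: complex. eigenfunction (l * (2 * \<rho> + l)) (u l) (u1 l)" and t: "t \<ge> 0"
  shows "((\<lambda>l. u l t) has_field_derivative of_real (M t)) (at 0)"
proof -
  define B where "B = M t / (2 * \<rho>) + (2 * \<rho> + 1)\<^sup>2 * (M t)\<^sup>2 / (2 * \<rho>\<^sup>2)"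
  \<comment> \<open>The radius \<open>d\<close> is chosen so that \<open>\<bar>l\<bar> \<bar>2\<rho> + l\<bar> M(t) \<le> \<rho>\<close> for \<open>\<bar>l\<bar> < d\<close>, the smallness needed for the first-order expansion.\<close>
  define d where "d = min 1 (\<rho> / ((2 * \<rho> + 1) * (M t + 1)))"
  have M: "M t \<ge> 0" by (rule M_nonneg[OF t])
  have d: "d > 0" unfolding d_def using M rho_pos by simp
  have u0: "u 0 t = 1"
    using eigenfunction_first_order[OF u[of 0] t] by simp
  have bound: "cmod (u l t - 1 - l * M t) \<le> B * (cmod l)\<^sup>2" if l: "cmod l < d" for l
  proof -
    have l1: "cmod l \<le> 1" and l2: "cmod l \<le> \<rho> / ((2 * \<rho> + 1) * (M t + 1))"
      using l by (auto simp: d_def)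
    have "cmod (2 * \<rho> + l) \<le> cmod (2 * \<rho>) + cmod l" by (rule norm_triangle_ineq)
    also have "\<dots> \<le> 2 * \<rho> + 1" using l1 rho_pos by (simp add: norm_mult)
    finally have nl: "cmod (2 * \<rho> + l) \<le> 2 * \<rho> + 1" .
    have q: "cmod (l * (2 * \<rho> + l)) \<le> cmod l * (2 * \<rho> + 1)"
      unfolding norm_mult by (rule mult_left_mono[OF nl]) simp
    have "cmod l * (2 * \<rho> + 1) * M t \<le> cmod l * (2 * \<rho> + 1) * (M t + 1)"
      using rho_pos by (intro mult_left_mono) auto
    also have "\<dots> = cmod l * ((2 * \<rho> + 1) * (M t + 1))" by simp
    also have "\<dots> \<le> \<rho>"
      using l2 rho_pos M by (subst (asm) pos_le_divide_eq) auto
    finally have "cmod (l * (2 * \<rho> + l)) * M t \<le> \<rho>"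
      using mult_right_mono[OF q M] by linarith
    then have small: "cmod (l * (2 * \<rho> + l)) * M t / (2 * \<rho>) \<le> 1 / 2"
      using rho_pos by (simp add: divide_le_eq)
    have fo: "cmod (u l t - 1 - l * (2 * \<rho> + l) * M t / (2 * \<rho>))
        \<le> (cmod (l * (2 * \<rho> + l)))\<^sup>2 * (M t)\<^sup>2 / (2 * \<rho>\<^sup>2)"
      by (rule eigenfunction_first_order[OF u t small])
    also have "\<dots> \<le> (cmod l * (2 * \<rho> + 1))\<^sup>2 * (M t)\<^sup>2 / (2 * \<rho>\<^sup>2)"
      by (intro divide_right_mono mult_right_mono power_mono q) simp_all
    finally have fo: "cmod (u l t - 1 - l * (2 * \<rho> + l) * M t / (2 * \<rho>))
        \<le> (cmod l * (2 * \<rho> + 1))\<^sup>2 * (M t)\<^sup>2 / (2 * \<rho>\<^sup>2)" .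
    have "u l t - 1 - l * M t = (u l t - 1 - l * (2 * \<rho> + l) * M t / (2 * \<rho>)) + l\<^sup>2 * of_real (M t / (2 * \<rho>))"
      using rho_pos by (simp add: field_simps power2_eq_square)
    then have "cmod (u l t - 1 - l * M t) \<le> cmod (u l t - 1 - l * (2 * \<rho> + l) * M t / (2 * \<rho>)) +
        cmod (l\<^sup>2 * of_real (M t / (2 * \<rho>)))"
      by (simp only: norm_triangle_ineq)
    also have "cmod (l\<^sup>2 * of_real (M t / (2 * \<rho>))) = (cmod l)\<^sup>2 * (M t / (2 * \<rho>))"
      unfolding norm_mult norm_power norm_of_real using M rho_pos by simp
    finally have "cmod (u l t - 1 - l * M t) \<le> (cmod l * (2 * \<rho> + 1))\<^sup>2 * (M t)\<^sup>2 / (2 * \<rho>\<^sup>2) +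
        (cmod l)\<^sup>2 * (M t / (2 * \<rho>))"
      using fo by linarith
    also have "\<dots> = B * (cmod l)\<^sup>2"
      unfolding B_def power_mult_distrib distrib_right
      by (simp only: times_divide_eq_left times_divide_eq_right mult_ac add_ac)
    finally show ?thesis .
  qed
  have "((\<lambda>l. (u l t - u 0 t) / l - M t) \<longlongrightarrow> 0) (at 0)"
  proof (rule Lim_null_comparison)
    show "\<forall>\<^sub>F l in at 0. cmod ((u l t - u 0 t) / l - M t) \<le> B * cmod l"
      unfolding eventually_at
    proof (intro exI[of _ d] conjI ballI impI d)
      fix l :: complex assume "l \<noteq> 0 \<and> dist l 0 < d"
      then have l: "l \<noteq> 0" "cmod l < d" by auto
      have "(u l t - u 0 t) / l - M t = (u l t - 1 - l * M t) / l"
        using l by (simp add: u0 field_simps)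
      then have "cmod ((u l t - u 0 t) / l - M t) = cmod (u l t - 1 - l * M t) / cmod l"
        by (simp only: norm_divide)
      also have "\<dots> \<le> B * (cmod l)\<^sup>2 / cmod l"
        by (rule divide_right_mono[OF bound[OF l(2)]]) simp
      also have "\<dots> = B * cmod l" using l by (simp add: power2_eq_square)
      finally show "cmod ((u l t - u 0 t) / l - M t) \<le> B * cmod l" .
    qed
    show "((\<lambda>l. B * cmod l) \<longlongrightarrow> 0) (at (0 :: complex))"
      by (rule tendsto_eq_intros refl | simp)+
  qed
  then have "((\<lambda>l. (u l t - u 0 t) / l) \<longlongrightarrow> M t) (at 0)"
    by (rule Lim_transform_eq[THEN iffD2, rotated] | simp add: LIM_zero_cancel)+
  then show ?thesis unfolding DERIV_def by simp
qed

text \<open>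
  With \<open>\<delta> = (a - 2\<rho>)/2\<close> and \<open>\<sigma> = (a + 2\<rho>)/2\<close> the functions \<open>p = (u + u'/l)/2\<close> and \<open>n = (u - u'/l)/2\<close> satisfy
  \<open>p' = (l - \<delta>) p + \<sigma> n\<close> and \<open>n' = (- l - \<sigma>) n + \<delta> p\<close>. For imaginary \<open>l\<close> this gives, formally,
  \<open>\<bar>p\<bar>' \<le> - \<delta>\<bar>p\<bar> + \<sigma>\<bar>n\<bar>\<close> and \<open>\<bar>n\<bar>' \<le> - \<sigma>\<bar>n\<bar> + \<delta>\<bar>p\<bar>\<close>, whose sum is \<open>0\<close>. So \<open>\<bar>p\<bar> + \<bar>n\<bar>\<close> decreases from its
  value \<open>1\<close> at the origin, and it bounds \<open>\<bar>u\<bar>\<close>.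
\<close>

lemma eigenfunction_bounded:
  fixes l :: complex
  assumes u: "eigenfunction (l * (2 * \<rho> + l)) u u1" and l: "Re l = 0" and t: "t \<ge> 0"
  shows "cmod (u t) \<le> 1"
proof (cases "l = 0")
  case True
  then show ?thesis using eigenfunction_first_order[OF u t] by simp
next
  case l0: False
  note ef = u[unfolded eigenfunction_def]
  define p n where "p s = (u s + u1 s / l) / 2" and "n s = (u s - u1 s / l) / 2" for s
  define f where "f s = cmod (p s) + cmod (n s)" for s
  have p_cont: "continuous_on {0..} p" and n_cont: "continuous_on {0..} n"
    unfolding p_def n_def using ef l0 by (auto intro!: continuous_intros)
  have dec: "f t \<le> f s" if s: "0 < s" "s \<le> t" for s
  proof (rule field_le_epsilon)
    fix e :: real assume e: "e > 0"
    define \<epsilon> where "\<epsilon> = e / (2 + \<bar>ln (A t) - ln (A s)\<bar>)"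
    have \<epsilon>: "\<epsilon> > 0" unfolding \<epsilon>_def using e by (intro divide_pos_pos) auto
    define S where "S g x = sqrt ((cmod (g x))\<^sup>2 + \<epsilon>\<^sup>2)" for g :: "real \<Rightarrow> complex" and x
    have S: "cmod (g x) \<le> S g x" "S g x \<le> cmod (g x) + \<epsilon>" "S g x > 0" for g x
    proof -
      show "cmod (g x) \<le> S g x" unfolding S_def by (rule real_le_rsqrt) simp
      show "S g x \<le> cmod (g x) + \<epsilon>" unfolding S_def
        using \<epsilon> by (intro real_le_lsqrt) (simp_all add: power2_sum)
      show "S g x > 0" unfolding S_def using \<epsilon> by (simp add: add_nonneg_pos)
    qed
    define h where "h x = \<epsilon> * ln (A x) - (S p x + S n x)" for x
    \<comment> \<open>The smoothed sum may grow at rate \<open>\<epsilon> (\<delta> + \<sigma>) = \<epsilon> a\<close>, the derivative of the term \<open>\<epsilon> ln A\<close> in \<open>h\<close>.\<close>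
    have "h s \<le> h t"
    proof (rule DERIV_nonneg_imp_nondecreasing[OF s(2)])
      fix x assume "s \<le> x" "x \<le> t"
      then have x: "x > 0" using s by simp
      define \<delta> \<sigma> where "\<delta> = (a x - 2 * \<rho>) / 2" and "\<sigma> = (a x + 2 * \<rho>) / 2"
      have \<delta>: "\<delta> \<ge> 0" and \<sigma>: "\<sigma> \<ge> 0" and sum: "\<delta> + \<sigma> = a x"
        using a_ge[OF x] rho_pos by (auto simp: \<delta>_def \<sigma>_def field_simps)
      define p' n' where "p' = (l - \<delta>) * p x + \<sigma> * n x" and "n' = (- l - \<sigma>) * n x + \<delta> * p x"
      have Du: "(u has_vector_derivative u1 x) (at x)"
        and Du1: "((\<lambda>x. u1 x / l) has_vector_derivative
          (l * (2 * \<rho> + l) * u x - a x * u1 x) / l) (at x)"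
        using ef x has_vector_derivative_mult_right[of u1 _ "at x" "inverse l"]
        by (auto simp: field_simps)
      have half: "((\<lambda>x. g x / 2) has_vector_derivative g' / 2) (at x)"
        if "(g has_vector_derivative g') (at x)" for g and g' :: complex
        using has_vector_derivative_mult_right[OF that, of "1/2"] by simp
      have "(p has_vector_derivative (u1 x + (l * (2 * \<rho> + l) * u x - a x * u1 x) / l) / 2) (at x)"
        unfolding p_def by (intro half has_vector_derivative_add Du Du1)
      also have "(u1 x + (l * (2 * \<rho> + l) * u x - a x * u1 x) / l) / 2 = p'"
        using l0 by (simp add: p'_def p_def n_def \<delta>_def \<sigma>_def field_simps)
      finally have Dp: "(p has_vector_derivative p') (at x)" .
      have "(n has_vector_derivative (u1 x - (l * (2 * \<rho> + l) * u x - a x * u1 x) / l) / 2) (at x)"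
        unfolding n_def by (intro half has_vector_derivative_diff Du Du1)
      also have "(u1 x - (l * (2 * \<rho> + l) * u x - a x * u1 x) / l) / 2 = n'"
        using l0 by (simp add: n'_def p_def n_def \<delta>_def \<sigma>_def field_simps)
      finally have Dn: "(n has_vector_derivative n') (at x)" .
      have DS: "(S p has_real_derivative inner (p x) p' / S p x) (at x)"
        "(S n has_real_derivative inner (n x) n' / S n x) (at x)"
        unfolding S_def by (rule smoothed_norm_deriv[OF _ \<epsilon>], fact)+
      have Dh: "(h has_real_derivative \<epsilon> * a x -
          (inner (p x) p' / S p x + inner (n x) n' / S n x)) (at x)"
        unfolding h_def
        by (intro DERIV_diff DERIV_add DERIV_cmult DS ln_A_deriv[OF x])
      define P N where "P = cmod (p x)" and "N = cmod (n x)"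
      have core: "inner z ((k + of_real c1) * z + of_real c2 * w) \<le> c1 * (cmod z)\<^sup>2 + c2 * (cmod z * cmod w)"
        if "Re k = 0" "c2 \<ge> 0" for z w k :: complex and c1 c2 :: real
      proof -
        have "inner z ((k + of_real c1) * z + of_real c2 * w) = c1 * inner z z + c2 * inner z w"
          using that(1) by (simp add: inner_complex_def algebra_simps)
        also have "\<dots> \<le> c1 * (cmod z)\<^sup>2 + c2 * (cmod z * cmod w)"
          unfolding power2_norm_eq_inner
          by (intro add_left_mono mult_left_mono norm_cauchy_schwarz that(2))
        finally show ?thesis .
      qed
      have ip: "inner (p x) p' \<le> - \<delta> * P\<^sup>2 + \<sigma> * (P * N)"
        using core[of l \<sigma> "p x" "- \<delta>" "n x"] l \<sigma> by (simp add: p'_def P_def N_def)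
      have "inner (n x) n' \<le> - \<sigma> * N\<^sup>2 + \<delta> * (N * P)"
        using core[of "- l" \<delta> "n x" "- \<sigma>" "p x"] l \<delta> by (simp add: n'_def P_def N_def)
      note inn = this
      have frac: "(- c * P\<^sup>2 + c' * (P * N)) / s \<le> - c * P + c * \<epsilon> + c' * N"
        if "c \<ge> 0" "c' \<ge> 0" "P \<ge> 0" "N \<ge> 0" "P \<le> s" "s \<le> P + \<epsilon>" "s > 0" for c c' P N s :: real
      proof -
        have "c' * N * P \<le> c' * N * s" using that by (intro mult_left_mono) auto
        moreover have "P * (s - P) \<le> s * \<epsilon>"
          using that \<epsilon> by (intro mult_mono) auto
        then have "c * (P * (s - P)) \<le> c * (s * \<epsilon>)" by (rule mult_left_mono) fact
        ultimately show ?thesis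
          unfolding pos_divide_le_eq[OF that(7)] by (simp add: algebra_simps power2_eq_square)
      qed
      have "inner (p x) p' / S p x \<le> (- \<delta> * P\<^sup>2 + \<sigma> * (P * N)) / S p x"
        using S(3)[of p x] by (intro divide_right_mono ip) simp
      also have "\<dots> \<le> - \<delta> * P + \<delta> * \<epsilon> + \<sigma> * N"
        using S[of p x] \<delta> \<sigma> by (intro frac) (simp_all add: P_def N_def)
      finally have 1: "inner (p x) p' / S p x \<le> - \<delta> * P + \<delta> * \<epsilon> + \<sigma> * N" .
      have "inner (n x) n' / S n x \<le> (- \<sigma> * N\<^sup>2 + \<delta> * (N * P)) / S n x"
        using S(3)[of n x] by (intro divide_right_mono inn) simp
      also have "\<dots> \<le> - \<sigma> * N + \<sigma> * \<epsilon> + \<delta> * P"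
        using S[of n x] \<delta> \<sigma> by (intro frac) (simp_all add: P_def N_def)
      finally have 2: "inner (n x) n' / S n x \<le> - \<sigma> * N + \<sigma> * \<epsilon> + \<delta> * P" .
      have "\<epsilon> * a x = \<delta> * \<epsilon> + \<sigma> * \<epsilon>"
        using A_pos[OF x] by (simp flip: sum add: algebra_simps)
      with 1 2 have "0 \<le> \<epsilon> * a x - (inner (p x) p' / S p x + inner (n x) n' / S n x)"
        by linarith
      with Dh show "\<exists>y. (h has_real_derivative y) (at x) \<and> 0 \<le> y" by blast
    qed
    then have "S p t + S n t \<le> S p s + S n s + \<epsilon> * (ln (A t) - ln (A s))"
      by (simp add: h_def algebra_simps)
    also have "\<dots> \<le> f s + 2 * \<epsilon> + \<epsilon> * \<bar>ln (A t) - ln (A s)\<bar>"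
    proof -
      have "\<epsilon> * (ln (A t) - ln (A s)) \<le> \<epsilon> * \<bar>ln (A t) - ln (A s)\<bar>"
        using \<epsilon> by (intro mult_left_mono) simp_all
      then show ?thesis
        using S(2)[of p s] S(2)[of n s] unfolding f_def by linarith
    qed
    also have "\<dots> = f s + \<epsilon> * (2 + \<bar>ln (A t) - ln (A s)\<bar>)" by (simp add: algebra_simps)
    also have "\<epsilon> * (2 + \<bar>ln (A t) - ln (A s)\<bar>) = e" unfolding \<epsilon>_def by simp
    finally show "f t \<le> f s + e"
      using S(1)[of p t] S(1)[of n t] by (simp add: f_def)
  qed
  have "f 0 = 1" using ef by (simp add: f_def p_def n_def)
  have le: "cmod (u t) \<le> f t"
  proof -
    have "u t = p t + n t" by (simp add: p_def n_def field_simps)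
    then show ?thesis unfolding f_def by (simp only: norm_triangle_ineq)
  qed
  show ?thesis
  proof (cases "t = 0")
    case True
    then show ?thesis using ef by simp
  next
    case False
    then have t: "t > 0" using t by simp
    have "continuous_on {0..} f" unfolding f_def using p_cont n_cont by (intro continuous_intros)
    then have "(f \<longlongrightarrow> f 0) (at 0 within {0..})" by (simp add: continuous_on_def)
    then have lim: "(f \<longlongrightarrow> f 0) (at_right 0)" by (rule tendsto_within_subset) auto
    have "\<forall>\<^sub>F s in at_right 0. f t \<le> f s"
      unfolding eventually_at_right_field using dec t by (intro exI[of _ t]) auto
    then have "f t \<le> f 0"
      by (rule tendsto_lowerbound[OF lim]) simp
    then show ?thesis using le \<open>f 0 = 1\<close> by simp
  qed
qed

definition "J = primitive (\<lambda>t. A t * (1 - k t))"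

text \<open>
  The regular solution of \<open>\<psi>' + a \<psi> = 2(1 - k)\<close>; it bounds the velocity \<open>\<bar>u' - l k u\<bar> / \<bar>l\<bar>\<^sup>2\<close> of the
  deviation from the exponential.
\<close>

definition "\<psi> t = 2 * J t / A t"

lemma J_cont: "continuous_on {0..} J"
  unfolding J_def by (intro primitive_continuous continuous_intros A_cont k_cont)

lemma J_deriv: "t \<ge> 0 \<Longrightarrow> (J has_real_derivative A t * (1 - k t)) (at t)"
  unfolding J_def by (rule primitive_deriv) (intro continuous_intros A_cont k_cont)

lemma J_0 [simp]: "J 0 = 0" by (simp add: J_def)

lemma J_nonneg: assumes "t \<ge> 0" shows "J t \<ge> 0"
proof -
  have "J 0 \<le> J t"
    by (rule mono_from_deriv[where f' = "\<lambda>t. A t * (1 - k t)"])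
      (simp_all add: assms J_cont J_deriv k_le_1 A_nonneg)
  then show ?thesis by simp
qed

lemma J_le_I: assumes "t \<ge> 0" shows "J t \<le> I t"
proof -
  have "I 0 - J 0 \<le> I t - J t"
  proof (rule mono_from_deriv[where f = "\<lambda>t. I t - J t" and f' = "\<lambda>t. A t - A t * (1 - k t)"])
    show "continuous_on {0..} (\<lambda>t. I t - J t)" by (intro continuous_intros I_cont J_cont)
    show "((\<lambda>t. I t - J t) has_real_derivative A s - A s * (1 - k s)) (at s)" if "s > 0" for s
      using that by (intro DERIV_diff I_deriv J_deriv) simp_all
    show "0 \<le> A s - A s * (1 - k s)" if "s > 0" for s
      using A_nonneg[of s] k_nonneg[of s] that by (simp add: algebra_simps)
  qed (use assms in auto)
  then show ?thesis by simp
qed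

lemma \<psi>_nonneg: "t \<ge> 0 \<Longrightarrow> \<psi> t \<ge> 0"
  unfolding \<psi>_def using J_nonneg A_nonneg by simp

lemma \<psi>_le_linear: assumes "t > 0" shows "\<psi> t \<le> 2 * t"
  unfolding \<psi>_def using J_le_I[of t] I_le_linear[of t] A_pos[OF assms] assms
  by (simp add: divide_le_eq)

lemma \<psi>_deriv: assumes "t > 0" shows "(\<psi> has_real_derivative 2 * (1 - k t) - a t * \<psi> t) (at t)"
proof -
  have nz: "A t \<noteq> 0" using A_pos[OF assms] by simp
  have "(\<psi> has_real_derivative ((2 * (A t * (1 - k t))) * A t - (2 * J t) * (a t * A t)) / (A t * A t)) (at t)"
    unfolding \<psi>_def using assms nz by (intro DERIV_divide DERIV_cmult A_deriv J_deriv) simp_all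
  also have "((2 * (A t * (1 - k t))) * A t - (2 * J t) * (a t * A t)) / (A t * A t) = 2 * (1 - k t) - a t * \<psi> t"
    using nz by (simp add: \<psi>_def field_simps)
  finally show ?thesis .
qed

text \<open>
  Since \<open>1 - k\<close> satisfies \<open>(1 - k)' = (a - 2\<rho>) - a (1 - k)\<close> and \<open>a \<ge> 2\<rho>\<close>, the equations for \<open>\<psi>\<close> and \<open>1 - k\<close>
  give \<open>2\<rho>\<psi> \<le> 2(1 - k) - \<psi>'\<close> and \<open>2\<rho>(1 - k) \<le> (a - 2\<rho>) - (1 - k)'\<close>. Inserting the second into
  the first and using \<open>a = (ln A)'\<close> leaves \<open>\<psi> \<le> \<Phi>'\<close>.
\<close>

definition "\<Phi> t = ((ln (A t) - 2 * \<rho> * t) / \<rho> - \<psi> t - (1 - k t) / \<rho>) / (2 * \<rho>)"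

lemma \<Phi>_deriv: assumes "t > 0"
  shows "\<exists>D. (\<Phi> has_real_derivative D) (at t) \<and> \<psi> t \<le> D"
proof (intro exI conjI)
  show "(\<Phi> has_real_derivative ((a t - 2 * \<rho>) / \<rho> - (2 * (1 - k t) - a t * \<psi> t) -
      (0 - (2 * \<rho> - a t * k t)) / \<rho>) / (2 * \<rho>)) (at t)"
  proof -
    have "((\<lambda>t. 2 * \<rho> * t) has_real_derivative 2 * \<rho>) (at t)"
      using DERIV_cmult[OF DERIV_ident, of "2 * \<rho>"] by simp
    then show ?thesis
      unfolding \<Phi>_def
      by (intro DERIV_cdivide DERIV_diff DERIV_const ln_A_deriv \<psi>_deriv k_deriv assms)
  qed
  have "((a t - 2 * \<rho>) / \<rho> - (2 * (1 - k t) - a t * \<psi> t) - (0 - (2 * \<rho> - a t * k t)) / \<rho>) =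
     a t * \<psi> t + (a t - 2 * \<rho>) * (1 - k t) / \<rho>"
    using rho_pos by (simp add: field_simps)
  moreover have "(a t - 2 * \<rho>) * (1 - k t) / \<rho> \<ge> 0"
    using a_ge[OF assms] k_le_1[of t] rho_pos assms by simp
  moreover have "a t * \<psi> t \<ge> 2 * \<rho> * \<psi> t"
    using a_ge[OF assms] \<psi>_nonneg[of t] assms by (intro mult_right_mono) simp_all
  ultimately have "2 * \<rho> * \<psi> t \<le> (a t - 2 * \<rho>) / \<rho> - (2 * (1 - k t) - a t * \<psi> t) - (0 - (2 * \<rho> - a t * k t)) / \<rho>"
    by linarith
  then show "\<psi> t \<le> ((a t - 2 * \<rho>) / \<rho> - (2 * (1 - k t) - a t * \<psi> t) -
      (0 - (2 * \<rho> - a t * k t)) / \<rho>) / (2 * \<rho>)"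
    using rho_pos by (simp add: le_divide_eq mult.commute)
qed

lemma \<Phi>_le_0: assumes "t > 0" shows "\<Phi> t \<le> 0"
proof -
  have "ln (A t) \<le> 2 * \<rho> * t"
    using A_le[OF assms] A_pos[OF assms] by (metis exp_gt_zero ln_exp ln_le_cancel_iff)
  then have "(ln (A t) - 2 * \<rho> * t) / \<rho> \<le> 0" using rho_pos by (simp add: divide_le_0_iff)
  moreover have "(1 - k t) / \<rho> \<ge> 0" using k_le_1[of t] assms rho_pos by simp
  ultimately have "(ln (A t) - 2 * \<rho> * t) / \<rho> - \<psi> t - (1 - k t) / \<rho> \<le> 0"
    using \<psi>_nonneg[of t] assms by linarith
  then show ?thesis
    using rho_pos unfolding \<Phi>_def by (intro divide_nonpos_pos) simp_all
qed

text \<open>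
  The quantity \<open>B = A e\<^bsup>lM\<^esup> (u' - l k u)\<close> has derivative \<open>l\<^sup>2 A e\<^bsup>lM\<^esup> (1 - k\<^sup>2) u\<close>: the terms of first order in
  \<open>l\<close> cancel by the equation \<open>k' + a k = 2\<rho>\<close>. Then use \<open>\<bar>u\<bar> \<le> 1\<close> and \<open>1 - k\<^sup>2 \<le> 2(1 - k)\<close>.
\<close>

lemma flow_bound:
  fixes l :: complex
  assumes u: "eigenfunction (l * (2 * \<rho> + l)) u u1" and l: "Re l = 0" and t: "t > 0"
  shows "cmod (u1 t - l * k t * u t) \<le> (cmod l)\<^sup>2 * \<psi> t"
proof -
  note ef = u[unfolded eigenfunction_def]
  define E where "E s = exp (l * of_real (M s))" for s
  have nE: "cmod (E s) = 1" for s using l by (simp add: E_def)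
  have DE: "(E has_vector_derivative l * k s * E s) (at s)" if "s > 0" for s
  proof -
    have "((\<lambda>s. of_real (M s) :: complex) has_vector_derivative of_real (k s)) (at s)"
      using that by (intro has_vector_derivative_of_real M_deriv) simp
    then have "((\<lambda>s. l * of_real (M s)) has_vector_derivative l * of_real (k s)) (at s)"
      by (rule has_vector_derivative_mult_right)
    from field_vector_diff_chain_at[OF this DERIV_exp] show ?thesis
      by (simp add: E_def[abs_def] o_def)
  qed
  have E_cont: "continuous_on {0..} E"
    unfolding E_def by (intro continuous_intros M_cont)
  have rk: "((\<lambda>s. complex_of_real (k s)) has_vector_derivative of_real (2 * \<rho> - a s * k s)) (at s)" if "s > 0" for s
    by (rule has_vector_derivative_of_real[OF k_deriv[OF that]])
  have rA: "((\<lambda>s. complex_of_real (A s)) has_vector_derivative of_real (a s * A s)) (at s)" if "s > 0" for s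
    by (rule has_vector_derivative_of_real[OF A_deriv[OF that]])
  define B where "B s = of_real (A s) * E s * (u1 s - l * (of_real (k s) * u s))" for s
  have "cmod (B t - B 0) \<le> (cmod l)\<^sup>2 * 2 * J t - (cmod l)\<^sup>2 * 2 * J 0"
  proof (rule norm_bound_from_deriv[where
        f' = "\<lambda>s. l\<^sup>2 * of_real (A s * (1 - (k s)\<^sup>2)) * E s * u s" and
        \<phi>' = "\<lambda>s. (cmod l)\<^sup>2 * 2 * (A s * (1 - k s))"])
    show "continuous_on {0..} B"
      unfolding B_def using ef by (intro continuous_intros A_cont E_cont k_cont) simp_all
    show "continuous_on {0..t} (\<lambda>s. (cmod l)\<^sup>2 * 2 * J s)"
      by (intro continuous_intros continuous_on_subset[OF J_cont]) auto
    fix s assume s: "0 < s" "s < t"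
    have Du: "(u has_vector_derivative u1 s) (at s)"
      and Du1: "(u1 has_vector_derivative l * (2 * \<rho> + l) * u s - a s * u1 s) (at s)"
      using ef s by simp_all
    have "(B has_vector_derivative
      (of_real (A s) * E s) * ((l * (2 * \<rho> + l) * u s - a s * u1 s) -
          l * (of_real (k s) * u1 s + of_real (2 * \<rho> - a s * k s) * u s)) +
      (of_real (A s) * (l * k s * E s) + of_real (a s * A s) * E s) * (u1 s - l * (of_real (k s) * u s))) (at s)"
      unfolding B_def
      by (intro has_vector_derivative_mult has_vector_derivative_mult_right has_vector_derivative_diff
          rA DE rk Du Du1 s)
    also have "(of_real (A s) * E s) * ((l * (2 * \<rho> + l) * u s - a s * u1 s) -
          l * (of_real (k s) * u1 s + of_real (2 * \<rho> - a s * k s) * u s)) +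
      (of_real (A s) * (l * k s * E s) + of_real (a s * A s) * E s) * (u1 s - l * (of_real (k s) * u s)) =
      l\<^sup>2 * of_real (A s * (1 - (k s)\<^sup>2)) * E s * u s"
      by (simp add: algebra_simps power2_eq_square)
    finally show "(B has_vector_derivative l\<^sup>2 * of_real (A s * (1 - (k s)\<^sup>2)) * E s * u s) (at s)" .
    show "((\<lambda>s. (cmod l)\<^sup>2 * 2 * J s) has_real_derivative (cmod l)\<^sup>2 * 2 * (A s * (1 - k s))) (at s)"
      using s by (intro DERIV_cmult J_deriv) simp
    have k: "0 \<le> k s" "k s \<le> 1" using k_nonneg k_le_1 s by simp_all
    have A: "A s \<ge> 0" using A_nonneg s by simp
    have "1 - (k s)\<^sup>2 = (1 + k s) * (1 - k s)" by (simp add: algebra_simps power2_eq_square)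
    also have "\<dots> \<le> 2 * (1 - k s)" using k by (intro mult_right_mono) simp_all
    finally have k2: "1 - (k s)\<^sup>2 \<le> 2 * (1 - k s)" .
    have k3: "1 - (k s)\<^sup>2 \<ge> 0" using k by (simp add: power_le_one)
    have "cmod (l\<^sup>2 * of_real (A s * (1 - (k s)\<^sup>2)) * E s * u s) = (cmod l)\<^sup>2 * (A s * (1 - (k s)\<^sup>2)) * cmod (u s)"
      using A k3 unfolding norm_mult norm_power nE norm_of_real by (simp add: abs_mult)
    also have "\<dots> \<le> (cmod l)\<^sup>2 * (A s * (1 - (k s)\<^sup>2)) * 1"
      using eigenfunction_bounded[OF u l, of s] s A k3 by (intro mult_left_mono) simp_all
    also have "\<dots> \<le> (cmod l)\<^sup>2 * (A s * (2 * (1 - k s))) * 1"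
      using k2 A by (intro mult_right_mono mult_left_mono) simp_all
    finally show "cmod (l\<^sup>2 * of_real (A s * (1 - (k s)\<^sup>2)) * E s * u s) \<le> (cmod l)\<^sup>2 * 2 * (A s * (1 - k s))"
      by (simp only: mult_ac mult_1_right)
  qed (use t in auto)
  moreover have "cmod (B t) = A t * cmod (u1 t - l * k t * u t)"
    using A_pos[OF t] nE by (simp add: B_def norm_mult mult.assoc)
  moreover have "B 0 = 0" by (simp add: B_def A_0)
  ultimately have "A t * cmod (u1 t - l * k t * u t) \<le> (cmod l)\<^sup>2 * 2 * J t" by simp
  then show ?thesis
    using A_pos[OF t] by (simp add: \<psi>_def le_divide_eq mult_ac)
qed

text \<open>
  The derivative of \<open>g = e\<^bsup>-lM\<^esup> u\<close> is \<open>e\<^bsup>-lM\<^esup> (u' - l k u)\<close>, hence at most \<open>\<bar>l\<bar>\<^sup>2 \<psi>\<close>. Integrating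
  \<open>\<psi> \<le> 2t\<close> over \<open>[0, 1]\<close> contributes \<open>1\<close> to the constant, and integrating \<open>\<psi> \<le> \<Phi>'\<close> over \<open>[1, t]\<close> contributes
  \<open>\<Phi>(t) - \<Phi>(1) \<le> - \<Phi>(1)\<close>. One cannot start the second estimate at \<open>0\<close>, where \<open>ln A\<close>
  diverges.
\<close>

lemma moment_approximation:
  fixes l :: complex
  assumes u: "eigenfunction (l * (2 * \<rho> + l)) u u1" and l: "Re l = 0" and t: "t \<ge> 0"
  shows "cmod (u t - exp (l * M t)) \<le> (1 - \<Phi> 1) * (cmod l)\<^sup>2"
proof -
  note ef = u[unfolded eigenfunction_def]
  define g where "g s = exp (- l * of_real (M s)) * u s" for s
  have nE: "cmod (exp (- l * of_real (M s))) = 1" for s using l by simp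
  define g' where "g' s = exp (- l * of_real (M s)) * (u1 s - l * k s * u s)" for s
  have g_cont: "continuous_on {0..} g"
    unfolding g_def using ef by (intro continuous_intros M_cont) simp_all
  have Dg: "(g has_vector_derivative g' s) (at s)" if "s > 0" for s
  proof -
    have "((\<lambda>s. of_real (M s) :: complex) has_vector_derivative of_real (k s)) (at s)"
      using that by (intro has_vector_derivative_of_real M_deriv) simp
    then have "((\<lambda>s. - l * of_real (M s)) has_vector_derivative - l * of_real (k s)) (at s)"
      by (rule has_vector_derivative_mult_right)
    from field_vector_diff_chain_at[OF this DERIV_exp]
    have "((\<lambda>s. exp (- l * of_real (M s))) has_vector_derivative
        - l * of_real (k s) * exp (- l * of_real (M s))) (at s)"
      by (simp add: o_def)
    from has_vector_derivative_mult[OF this, of u "u1 s"] ef that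
    show ?thesis unfolding g_def[abs_def] g'_def by (simp add: algebra_simps)
  qed
  have g'_le: "cmod (g' s) \<le> (cmod l)\<^sup>2 * \<psi> s" if "s > 0" for s
    using flow_bound[OF u l that] unfolding g'_def norm_mult nE by simp
  have near: "cmod (g s - g 0) \<le> (cmod l)\<^sup>2" if s: "0 \<le> s" "s \<le> 1" for s
  proof -
    have "cmod (g s - g 0) \<le> (cmod l)\<^sup>2 * s\<^sup>2 - (cmod l)\<^sup>2 * 0\<^sup>2"
    proof (rule norm_bound_from_deriv[where \<phi>' = "\<lambda>x. (cmod l)\<^sup>2 * (2 * x)", OF _ _ g_cont _ Dg])
      show "continuous_on {0..s} (\<lambda>s. (cmod l)\<^sup>2 * s\<^sup>2)" by (intro continuous_intros)
      fix x assume x: "0 < x" "x < s"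
      show "((\<lambda>s. (cmod l)\<^sup>2 * s\<^sup>2) has_real_derivative (cmod l)\<^sup>2 * (2 * x)) (at x)"
        by (rule derivative_eq_intros refl | simp)+
      have "(cmod l)\<^sup>2 * \<psi> x \<le> (cmod l)\<^sup>2 * (2 * x)"
        by (rule mult_left_mono[OF \<psi>_le_linear[OF x(1)]]) simp
      then show "cmod (g' x) \<le> (cmod l)\<^sup>2 * (2 * x)" using g'_le[OF x(1)] by linarith
    qed (use s in auto)
    also have "\<dots> \<le> (cmod l)\<^sup>2 * 1"
      using s by (simp add: mult_left_le power_le_one)
    finally show ?thesis by simp
  qed
  have \<Phi>1: "\<Phi> 1 \<le> 0" by (rule \<Phi>_le_0) simp
  have "cmod (g t - g 0) \<le> (1 - \<Phi> 1) * (cmod l)\<^sup>2"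
  proof (cases "t \<le> 1")
    case True
    have "1 * (cmod l)\<^sup>2 \<le> (1 - \<Phi> 1) * (cmod l)\<^sup>2" using \<Phi>1 by (intro mult_right_mono) simp_all
    then show ?thesis using near[OF t True] by linarith
  next
    case False
    then have t1: "t > 1" by simp
    obtain D where D: "\<And>x. x > 0 \<Longrightarrow> (\<Phi> has_real_derivative D x) (at x)" "\<And>x. x > 0 \<Longrightarrow> \<psi> x \<le> D x"
      using \<Phi>_deriv by metis
    have "cmod (g t - g 1) \<le> (cmod l)\<^sup>2 * \<Phi> t - (cmod l)\<^sup>2 * \<Phi> 1"
    proof (rule norm_bound_from_deriv[where \<phi>' = "\<lambda>x. (cmod l)\<^sup>2 * D x", OF _ _ g_cont _ Dg])
      show "continuous_on {1..t} (\<lambda>s. (cmod l)\<^sup>2 * \<Phi> s)"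
      proof (intro continuous_intros continuous_at_imp_continuous_on ballI)
        fix x assume "x \<in> {1..t}"
        then show "isCont \<Phi> x" by (intro DERIV_isCont[OF D(1)]) simp
      qed
      fix x assume x: "1 < x" "x < t"
      then have x0: "x > 0" by simp
      show "((\<lambda>s. (cmod l)\<^sup>2 * \<Phi> s) has_real_derivative (cmod l)\<^sup>2 * D x) (at x)"
        by (rule DERIV_cmult[OF D(1)[OF x0]])
      have "(cmod l)\<^sup>2 * \<psi> x \<le> (cmod l)\<^sup>2 * D x"
        by (rule mult_left_mono[OF D(2)[OF x0]]) simp
      then show "cmod (g' x) \<le> (cmod l)\<^sup>2 * D x" using g'_le[OF x0] by linarith
    qed (use t1 in auto)
    also have "\<dots> \<le> - \<Phi> 1 * (cmod l)\<^sup>2"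
      using mult_left_mono[OF \<Phi>_le_0[of t], of "(cmod l)\<^sup>2"] t1 by (simp add: mult.commute)
    finally have "cmod (g t - g 1) \<le> - \<Phi> 1 * (cmod l)\<^sup>2" .
    moreover have "cmod (g t - g 0) \<le> cmod (g t - g 1) + cmod (g 1 - g 0)"
      using norm_triangle_ineq[of "g t - g 1" "g 1 - g 0"] by simp
    ultimately have "cmod (g t - g 0) \<le> - \<Phi> 1 * (cmod l)\<^sup>2 + (cmod l)\<^sup>2"
      using near[of 1] by simp
    then show ?thesis by (simp add: algebra_simps)
  qed
  moreover have "g 0 = 1" using ef by (simp add: g_def)
  moreover have "u t - exp (l * M t) = exp (l * M t) * (g t - 1)"
  proof -
    have "exp (l * M t) * exp (- l * M t) = 1" by (simp flip: exp_add)
    then show ?thesis by (simp add: g_def right_diff_distrib flip: mult.assoc)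
  qed
  then have "cmod (u t - exp (l * M t)) = cmod (g t - 1)"
    using l by (simp add: norm_mult)
  ultimately show ?thesis by simp
qed

end

section \<open>Jacobi functions\<close>

definition jacobi_weight :: "real \<Rightarrow> real \<Rightarrow> real \<Rightarrow> real" where
  "jacobi_weight \<alpha> \<beta> t = sinh t powr (2 * \<alpha> + 1) * cosh t powr (2 * \<beta> + 1)"

text \<open>
  The logarithmic derivative of the weight.
\<close>

definition jacobi_drift :: "real \<Rightarrow> real \<Rightarrow> real \<Rightarrow> real" where
  "jacobi_drift \<alpha> \<beta> t = (2 * \<alpha> + 1) * (cosh t / sinh t) + (2 * \<beta> + 1) * (sinh t / cosh t)"

text \<open>
  For the lower bound on the drift, write
  \<open>(2\<alpha> + 1) x + (2\<beta> + 1) y = 2(\<alpha> - \<beta>) x + (2\<beta> + 1)(x + y)\<close> with \<open>x = coth t \<ge> 1\<close> and \<open>y = tanh t = 1/x\<close>, so that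
  \<open>x + y \<ge> 2\<close>; all coefficients are nonnegative.
\<close>

lemma sturm_liouville_weight_jacobi:
  fixes \<alpha> \<beta> :: real
  assumes "\<alpha> \<ge> \<beta>" "\<beta> \<ge> - 1 / 2" "\<alpha> > - 1 / 2"
  shows "sturm_liouville_weight (jacobi_weight \<alpha> \<beta>) (jacobi_drift \<alpha> \<beta>) (jacobi_rho \<alpha> \<beta>)"
proof
  show "jacobi_rho \<alpha> \<beta> > 0" using assms by (simp add: jacobi_rho_def)
  show "continuous_on {0..} (jacobi_weight \<alpha> \<beta>)"
    unfolding jacobi_weight_def using assms
    by (intro continuous_on_mult continuous_on_powr' continuous_intros) (auto simp: less_imp_neq)
  show "jacobi_weight \<alpha> \<beta> 0 = 0" by (simp add: jacobi_weight_def)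
  fix t :: real assume t: "t > 0"
  then have s: "sinh t > 0" and c: "cosh t > 0" by simp_all
  show "jacobi_weight \<alpha> \<beta> t > 0" unfolding jacobi_weight_def using s c by simp
  have dp: "((\<lambda>t. f t powr r) has_real_derivative r * (f' / f t) * f t powr r) (at t)"
    if "(f has_real_derivative f') (at t)" "f t > 0" for f f' r
  proof -
    have "((\<lambda>t. f t powr r) has_real_derivative r * f t powr (r - 1) * f') (at t)"
      using DERIV_chain2[OF has_real_derivative_powr[OF that(2)] that(1)] by simp
    then show ?thesis using that(2) by (simp add: powr_diff field_simps)
  qed
  have "(sinh has_real_derivative cosh t) (at t)" "(cosh has_real_derivative sinh t) (at t)"
    by (auto intro!: derivative_eq_intros)
  note D = DERIV_mult[OF dp[OF this(1) s] dp[OF this(2) c], of "2 * \<alpha> + 1" "2 * \<beta> + 1"]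
  show "(jacobi_weight \<alpha> \<beta> has_real_derivative jacobi_drift \<alpha> \<beta> t * jacobi_weight \<alpha> \<beta> t) (at t)"
    using D unfolding jacobi_weight_def[abs_def] jacobi_drift_def by (simp add: algebra_simps)
  show "2 * jacobi_rho \<alpha> \<beta> \<le> jacobi_drift \<alpha> \<beta> t"
  proof -
    let ?x = "cosh t / sinh t" and ?y = "sinh t / cosh t"
    have "sinh t < cosh t" by (rule sinh_less_cosh_real)
    then have x: "?x \<ge> 1" using s by simp
    have "0 \<le> (cosh t - sinh t)\<^sup>2 / (sinh t * cosh t)" using s c by simp
    also have "\<dots> = ?x + ?y - 2" using s c by (simp add: field_simps power2_eq_square)
    finally have xy: "?x + ?y \<ge> 2" by simp
    have "2 * jacobi_rho \<alpha> \<beta> = 2 * (\<alpha> - \<beta>) * 1 + (2 * \<beta> + 1) * 2"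
      by (simp add: jacobi_rho_def)
    also have "\<dots> \<le> 2 * (\<alpha> - \<beta>) * ?x + (2 * \<beta> + 1) * (?x + ?y)"
      using assms x xy by (intro add_mono mult_left_mono) simp_all
    also have "\<dots> = jacobi_drift \<alpha> \<beta> t" by (simp only: jacobi_drift_def) algebra
    finally show ?thesis .
  qed
  have "sinh t \<le> exp t" "cosh t \<le> exp t"
    using t exp_gt_zero[of t] exp_gt_zero[of "- t"] unfolding sinh_field_def cosh_field_def
    by (simp_all add: field_simps)
  then have "jacobi_weight \<alpha> \<beta> t \<le> exp t powr (2 * \<alpha> + 1) * exp t powr (2 * \<beta> + 1)"
    unfolding jacobi_weight_def using assms s c by (intro mult_mono powr_mono2) simp_all
  also have "\<dots> = exp (2 * jacobi_rho \<alpha> \<beta> * t)"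
    by (simp add: exp_powr_real jacobi_rho_def algebra_simps flip: exp_add)
  finally show "jacobi_weight \<alpha> \<beta> t \<le> exp (2 * jacobi_rho \<alpha> \<beta> * t)" .
qed

text \<open>
  At \<open>\<mu> = \<i>\<rho> + \<i>l\<close> the parameters of the hypergeometric function are \<open>\<rho> + l/2\<close> and \<open>- l/2\<close>, with product
  \<open>- l(2\<rho> + l)/4\<close>. Under \<open>z = - sinh\<^sup>2 t\<close> the hypergeometric operator becomes \<open>- 1/4\<close> times the radial operator
  of the Jacobi weight.
\<close>

lemma jacobi_fun_eigenfunction:
  fixes \<alpha> \<beta> :: real and l :: complex
  assumes "\<alpha> \<ge> \<beta>" "\<beta> \<ge> - 1 / 2" "\<alpha> > - 1 / 2"
  defines "\<rho> \<equiv> jacobi_rho \<alpha> \<beta>"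
  shows "\<exists>u1. sturm_liouville_weight.eigenfunction (jacobi_drift \<alpha> \<beta>) (l * (2 * of_real \<rho> + l))
           (jacobi_fun \<alpha> \<beta> (\<i> * of_real \<rho> + \<i> * l)) u1"
proof -
  interpret sturm_liouville_weight "jacobi_weight \<alpha> \<beta>" "jacobi_drift \<alpha> \<beta>" "jacobi_rho \<alpha> \<beta>"
    by (rule sturm_liouville_weight_jacobi) fact+
  define a b c :: complex where "a = of_real \<rho> + l / 2" and "b = - l / 2" and "c = of_real (\<alpha> + 1)"
  define z where "z t = complex_of_real (- (sinh t)\<^sup>2)" for t
  define u where "u t = hyp2F1 a b c (z t)" for t
  have ueq: "jacobi_fun \<alpha> \<beta> (\<i> * of_real \<rho> + \<i> * l) = u"
  proof
    fix t
    have "(of_real (\<alpha> + \<beta> + 1) - \<i> * (\<i> * of_real \<rho> + \<i> * l)) / 2 = a"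
      "(of_real (\<alpha> + \<beta> + 1) + \<i> * (\<i> * of_real \<rho> + \<i> * l)) / 2 = b"
      by (simp_all add: a_def b_def \<rho>_def jacobi_rho_def field_simps)
    then show "jacobi_fun \<alpha> \<beta> (\<i> * of_real \<rho> + \<i> * l) t = u t"
      by (simp only: jacobi_fun_def u_def z_def c_def)
  qed
  have c: "c \<noteq> - of_nat n" for n
  proof
    assume "c = - of_nat n"
    then have "Re c = - real n" by simp
    then show False using assms by (simp add: c_def)
  qed
  obtain h1 h2 where h: "hyp2F1 a b c 0 = 1"
    "\<And>z. z \<in> slit_plane \<Longrightarrow> (hyp2F1 a b c has_field_derivative h1 z) (at z)"
    "\<And>z. z \<in> slit_plane \<Longrightarrow> (h1 has_field_derivative h2 z) (at z)"
    "\<And>z. z \<in> slit_plane \<Longrightarrow> z \<noteq> 0 \<Longrightarrow>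
       z * (1 - z) * h2 z + (c - (a + b + 1) * z) * h1 z = a * b * hyp2F1 a b c z"
    using hyp2F1_ode[OF c, of a b] by blast
  have z_slit: "z t \<in> slit_plane" for t
  proof -
    have "z t \<noteq> of_real x" if "x \<in> {1..}" for x
    proof
      assume "z t = of_real x"
      then have "- (sinh t)\<^sup>2 = x" unfolding z_def of_real_eq_iff .
      then show False using that zero_le_power2[of "sinh t"] by auto
    qed
    then show ?thesis unfolding slit_plane_def by blast
  qed
  have Dz: "(z has_vector_derivative of_real (- (2 * sinh t * cosh t))) (at t)" for t
    unfolding z_def
    by (rule has_vector_derivative_of_real) (auto intro!: derivative_eq_intros)
  define w where "w t = complex_of_real (- (2 * sinh t * cosh t))" for t
  have Dw: "(w has_vector_derivative of_real (- (2 * ((sinh t)\<^sup>2 + (cosh t)\<^sup>2)))) (at t)" for t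
    unfolding w_def
    by (rule has_vector_derivative_of_real)
      (auto intro!: derivative_eq_intros simp: power2_eq_square)
  define u1 where "u1 t = w t * h1 (z t)" for t
  define u2 where "u2 t = w t * (w t * h2 (z t)) + of_real (- (2 * ((sinh t)\<^sup>2 + (cosh t)\<^sup>2))) * h1 (z t)" for t
  have Du: "(u has_vector_derivative u1 t) (at t)" for t
    using field_vector_diff_chain_at[OF Dz h(2)[OF z_slit]]
    by (simp add: u_def[abs_def] u1_def w_def o_def)
  have Du1: "(u1 has_vector_derivative u2 t) (at t)" for t
    using has_vector_derivative_mult[OF Dw field_vector_diff_chain_at[OF Dz h(3)[OF z_slit]]]
    by (simp add: u1_def[abs_def] u2_def w_def o_def)
  have cont: "continuous_on {0..} f" if "\<And>t. (f has_vector_derivative f' t) (at t)" for f f' :: "real \<Rightarrow> complex"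
    using that by (intro continuous_at_imp_continuous_on ballI has_vector_derivative_continuous)
  have ode: "u2 t = l * (2 * of_real \<rho> + l) * u t - of_real (jacobi_drift \<alpha> \<beta> t) * u1 t" if t: "t > 0" for t
  proof -
    define S C :: complex where "S = of_real (sinh t)" and "C = of_real (cosh t)"
    have nz: "S \<noteq> 0" "C \<noteq> 0" using t by (simp_all add: S_def C_def)
    have CS: "C\<^sup>2 = 1 + S\<^sup>2"
      unfolding C_def S_def of_real_power[symmetric] cosh_square_eq by simp
    have zt: "z t = - S\<^sup>2" and wt: "w t = - (2 * S * C)" by (simp_all add: z_def w_def S_def C_def)
    have a: "of_real (jacobi_drift \<alpha> \<beta> t) * u1 t =
        - 2 * (of_real (2 * \<alpha> + 1) * C\<^sup>2 + of_real (2 * \<beta> + 1) * S\<^sup>2) * h1 (z t)"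
      using nz by (simp add: jacobi_drift_def u1_def wt S_def[symmetric] C_def[symmetric] field_simps power2_eq_square)
    have "z t \<noteq> 0" using nz by (simp add: zt)
    from h(4)[OF z_slit this]
    have eq: "- S\<^sup>2 * C\<^sup>2 * h2 (z t) + (of_real (\<alpha> + 1) + (of_real \<rho> + 1) * S\<^sup>2) * h1 (z t) =
        - (l * (2 * of_real \<rho> + l) / 4) * u t"
      unfolding CS by (simp add: u_def a_def b_def c_def zt field_simps power2_eq_square)
    have u2: "u2 t = 4 * (S\<^sup>2 * C\<^sup>2 * h2 (z t)) - 2 * (S\<^sup>2 + C\<^sup>2) * h1 (z t)"
      unfolding u2_def wt by (simp add: S_def C_def power2_eq_square algebra_simps)
    have r: "of_real \<rho> = of_real \<alpha> + of_real \<beta> + (1 :: complex)" by (simp add: \<rho>_def jacobi_rho_def)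
    have "l * (2 * of_real \<rho> + l) * u t = 4 * (S\<^sup>2 * C\<^sup>2 * h2 (z t)) - 4 * ((of_real (\<alpha> + 1) + (of_real \<rho> + 1) * S\<^sup>2) * h1 (z t))"
      using eq by (simp add: field_simps)
    then show ?thesis unfolding u2 a CS r by (simp add: algebra_simps)
  qed
  have "eigenfunction (l * (2 * of_real \<rho> + l)) u u1"
    unfolding eigenfunction_def
  proof (intro conjI allI impI)
    show "u 0 = 1" by (simp add: u_def z_def h)
    show "u1 0 = 0" by (simp add: u1_def w_def)
    show "continuous_on {0..} u" "continuous_on {0..} u1"
      by (rule cont[OF Du], rule cont[OF Du1])
    show "(u has_vector_derivative u1 t) (at t)" for t by (rule Du)
    show "(u1 has_vector_derivative l * (2 * of_real \<rho> + l) * u t - of_real (jacobi_drift \<alpha> \<beta> t) * u1 t) (at t)"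
      if "t > 0" for t
      using Du1[of t] unfolding ode[OF that] .
  qed
  then show ?thesis unfolding ueq by blast
qed

theorem proposition2p5:
  fixes \<alpha> \<beta> :: real
  assumes "\<alpha> \<ge> \<beta>" and "\<beta> \<ge> - 1 / 2" and "\<alpha> > - 1 / 2"
  shows "\<exists>C::real. \<forall>t::real. \<forall>l::real. t \<ge> 0 \<longrightarrow>
           cmod (jacobi_fun \<alpha> \<beta> (\<i> * of_real (jacobi_rho \<alpha> \<beta>) - of_real l) t
                 - exp (\<i> * of_real l * jacobi_m1 \<alpha> \<beta> t))
             \<le> C * (l\<^sup>2 + \<bar>l\<bar> ^ 3)"
proof -
  interpret sturm_liouville_weight "jacobi_weight \<alpha> \<beta>" "jacobi_drift \<alpha> \<beta>" "jacobi_rho \<alpha> \<beta>"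
    by (rule sturm_liouville_weight_jacobi) fact+
  define u where "u l = jacobi_fun \<alpha> \<beta> (\<i> * of_real (jacobi_rho \<alpha> \<beta>) + \<i> * l)" for l
  obtain u1 where u: "\<And>l. eigenfunction (l * (2 * of_real (jacobi_rho \<alpha> \<beta>) + l)) (u l) (u1 l)"
    using jacobi_fun_eigenfunction[OF assms] unfolding u_def by metis
  have m1: "jacobi_m1 \<alpha> \<beta> t = of_real (M t)" if "t \<ge> 0" for t
    unfolding jacobi_m1_def u_def[symmetric]
    by (rule DERIV_imp_deriv[OF moment_derivative[OF _ that]]) (use u in simp)
  show ?thesis
  proof (intro exI[of _ "1 - \<Phi> 1"] allI impI)
    fix t l :: real assume t: "t \<ge> 0"
    let ?l = "\<i> * complex_of_real l"
    have "jacobi_fun \<alpha> \<beta> (\<i> * of_real (jacobi_rho \<alpha> \<beta>) - of_real l) = u ?l"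
      by (simp add: u_def flip: mult.assoc)
    moreover have "cmod (u ?l t - exp (?l * of_real (M t))) \<le> (1 - \<Phi> 1) * (cmod ?l)\<^sup>2"
      by (rule moment_approximation[OF _ _ t, of _ _ "u1 ?l"]) (use u[of ?l] in simp_all)
    ultimately have "cmod (jacobi_fun \<alpha> \<beta> (\<i> * of_real (jacobi_rho \<alpha> \<beta>) - of_real l) t
                 - exp (\<i> * of_real l * jacobi_m1 \<alpha> \<beta> t)) \<le> (1 - \<Phi> 1) * l\<^sup>2"
      by (simp add: m1[OF t] norm_mult)
    also have "\<dots> \<le> (1 - \<Phi> 1) * (l\<^sup>2 + \<bar>l\<bar> ^ 3)"
      using \<Phi>_le_0[of 1] by (intro mult_left_mono) simp_all
    finally show "cmod (jacobi_fun \<alpha> \<beta> (\<i> * of_real (jacobi_rho \<alpha> \<beta>) - of_real l) t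
                 - exp (\<i> * of_real l * jacobi_m1 \<alpha> \<beta> t)) \<le> (1 - \<Phi> 1) * (l\<^sup>2 + \<bar>l\<bar> ^ 3)" .
  qed
qed

end
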